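(* Let $n\ge 1$, let $1<p<\infty$, and let $u\in C(\overline{B}_1(0))$ be a viscosity solution to the normalized $p$-Laplace equation $\Delta_p^N u=0$ in $B_1(0)\subset\mathbb{R}^n$. Then for any $\delta\in(0,1)$ there is a constant $C>0$ such that $$|u(x)-u(y)|\le C|x-y|^{\delta}\quad\text{for all } x,y\in B_{1/4}(0).$$
   Context: $B_r(0)$ denotes the open ball of radius $r$ centered at the origin in $\mathbb{R}^n$, and $\overline{B}_r(0)$ its closure. For a $C^2$ function $\varphi$ and a point where $D\varphi\neq 0$, the normalized (game-theoretic) infinity Laplacian and the normalized $p$-Laplacian are $$\Delta_\infty^N\varphi=|D\varphi|^{-2}\langle D^2\varphi\, D\varphi, D\varphi\rangle,$$ $$\Delta_p^N\varphi=\Delta\varphi+(p-2)\Delta_\infty^N\varphi=\operatorname{tr}\left\{\left(I+(p-2)\frac{D\varphi}{|D\varphi|}\otimes\frac{D\varphi}{|D\varphi|}\right)D^2\varphi\right\},$$ where $(a\otimes b)_{ij}=a_ib_j$. A continuous function $u$ is a viscosity solution of $\Delta_p^N u=0$ in $B_1(0)$ if for every $x_0\in B_1(0)$ and every $C^2$ function $\varphi$ defined near $x_0$ with $D\varphi(x_0)\neq 0$: (i) if $u-\varphi$ has a local maximum at $x_0$, then $\Delta_p^N\varphi(x_0)\ge 0$; and (ii) if $u-\varphi$ has a local minimum at $x_0$, then $\Delta_p^N\varphi(x_0)\le 0$. *)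

theory Defs
  imports "HOL-Analysis.Analysis"
begin

definition gradient :: "(real ^ 'n \<Rightarrow> real) \<Rightarrow> real ^ 'n \<Rightarrow> real ^ 'n" where
  "gradient f x = (\<chi> i. frechet_derivative f (at x) (axis i 1))"

definition hessian :: "(real ^ 'n \<Rightarrow> real) \<Rightarrow> real ^ 'n \<Rightarrow> real ^ 'n ^ 'n" where
  "hessian f x = jacobian (gradient f) (at x)"

text \<open>Intended for open \<open>U\<close>. Both derivatives are required to exist on \<open>U\<close>, so the values of
  \<^const>\<open>gradient\<close> and \<^const>\<open>hessian\<close> there are the genuine ones; continuity of the function
  and of its gradient follows from differentiability.\<close>

definition C2_on :: "(real ^ 'n) set \<Rightarrow> (real ^ 'n \<Rightarrow> real) \<Rightarrow> bool" where
  "C2_on U f \<longleftrightarrow>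
     (\<forall>x\<in>U. f differentiable (at x)) \<and>
     (\<forall>x\<in>U. gradient f differentiable (at x)) \<and>
     continuous_on U (hessian f)"

definition laplacian :: "(real ^ 'n \<Rightarrow> real) \<Rightarrow> real ^ 'n \<Rightarrow> real" where
  "laplacian f x = trace (hessian f x)"

text \<open>Only meaningful where the gradient does not vanish.\<close>

definition normalized_infinity_laplacian :: "(real ^ 'n \<Rightarrow> real) \<Rightarrow> real ^ 'n \<Rightarrow> real" where
  "normalized_infinity_laplacian f x =
     inverse ((norm (gradient f x))\<^sup>2) * ((hessian f x *v gradient f x) \<bullet> gradient f x)"

definition normalized_p_laplacian :: "real \<Rightarrow> (real ^ 'n \<Rightarrow> real) \<Rightarrow> real ^ 'n \<Rightarrow> real" where
  "normalized_p_laplacian p f x =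
     laplacian f x + (p - 2) * normalized_infinity_laplacian f x"

definition tensor :: "real ^ 'n \<Rightarrow> real ^ 'n \<Rightarrow> real ^ 'n ^ 'n" where
  "tensor a b = (\<chi> i j. a $ i * b $ j)"

lemma trace_tensor_mult:
  fixes A :: "real ^ 'n ^ 'n"
  shows "trace (tensor a b ** A) = (A *v a) \<bullet> b"
proof -
  have "trace (tensor a b ** A) = (\<Sum>i\<in>UNIV. \<Sum>k\<in>UNIV. a $ i * b $ k * A $ k $ i)"
    by (simp add: trace_def tensor_def matrix_matrix_mult_def)
  also have "\<dots> = (\<Sum>k\<in>UNIV. \<Sum>i\<in>UNIV. a $ i * b $ k * A $ k $ i)"
    by (rule sum.swap)
  also have "\<dots> = (A *v a) \<bullet> b"
    by (simp add: inner_vec_def matrix_vector_mult_def sum_distrib_left sum_distrib_right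
        mult_ac)
  finally show ?thesis .
qed

lemma normalized_p_laplacian_eq_trace:
  fixes f :: "real ^ 'n \<Rightarrow> real"
  defines "\<nu> \<equiv> \<lambda>x. gradient f x /\<^sub>R norm (gradient f x)"
  shows "normalized_p_laplacian p f x =
    trace ((mat 1 + (p - 2) *\<^sub>R tensor (\<nu> x) (\<nu> x)) ** hessian f x)"
proof -
  have "trace ((c *\<^sub>R B) ** A) = c * trace (B ** A)" for c and A B :: "real ^ 'n ^ 'n"
    by (simp add: trace_def matrix_matrix_mult_def sum_distrib_left mult_ac)
  moreover have "(A + B) ** C = A ** C + B ** C" for A B C :: "real ^ 'n ^ 'n"
    by (simp add: vec_eq_iff matrix_matrix_mult_def sum.distrib distrib_right)
  ultimately show ?thesis
    by (simp add: normalized_p_laplacian_def laplacian_def normalized_infinity_laplacian_def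
        trace_add trace_tensor_mult \<nu>_def matrix_vector_mult_scaleR
        power2_eq_square)
qed

definition local_max_at :: "('a::topological_space \<Rightarrow> real) \<Rightarrow> 'a \<Rightarrow> bool" where
  "local_max_at f x0 \<longleftrightarrow> (\<forall>\<^sub>F x in nhds x0. f x \<le> f x0)"

definition local_min_at :: "('a::topological_space \<Rightarrow> real) \<Rightarrow> 'a \<Rightarrow> bool" where
  "local_min_at f x0 \<longleftrightarrow> (\<forall>\<^sub>F x in nhds x0. f x0 \<le> f x)"

text \<open>Intended for open \<open>\<Omega>\<close>. The test function is only required to be \<open>C\<^sup>2\<close> on some
  neighbourhood \<open>U\<close> of the touching point. Values of \<open>u\<close> outside \<open>\<Omega>\<close> and of \<open>\<phi>\<close> outside
  \<open>U\<close> play no role, since a local extremum concerns only points close to \<open>x0\<close>.\<close>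

definition viscosity_solution ::
    "real \<Rightarrow> (real ^ 'n) set \<Rightarrow> (real ^ 'n \<Rightarrow> real) \<Rightarrow> bool" where
  "viscosity_solution p \<Omega> u \<longleftrightarrow>
     continuous_on \<Omega> u \<and>
     (\<forall>x0\<in>\<Omega>. \<forall>U \<phi>. open U \<and> x0 \<in> U \<and> C2_on U \<phi> \<and> gradient \<phi> x0 \<noteq> 0 \<longrightarrow>
        (local_max_at (\<lambda>x. u x - \<phi> x) x0 \<longrightarrow> normalized_p_laplacian p \<phi> x0 \<ge> 0) \<and>
        (local_min_at (\<lambda>x. u x - \<phi> x) x0 \<longrightarrow> normalized_p_laplacian p \<phi> x0 \<le> 0))"

end

theory Submission
  imports Defs
begin

text \<open>Ishii--Lions doubling of variables, arranged so that neither Alexandrov's theorem nor the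
  theorem on sums is needed. If \<open>u x0 - u y0 > L |x0 - y0|\<^sup>\<delta>\<close> for a large
  \<open>L\<close>, let \<open>f\<close> and \<open>g\<close> be sup-convolutions of \<open>u\<close> and
  \<open>-u\<close> with small parameter, and maximize
  \<open>f x + g y - L |x - y|\<^sup>\<delta> - N |x - x0|\<^sup>2\<close>. Both functions are differentiable at the maximum point, with almost parallel large
  gradients. Being semiconvex, each is nearby a subsolution, up to an arbitrarily small error, of the linear
  equation whose coefficients are frozen at that gradient; a linear change of variables turns the frozen
  operator into the Laplacian. Choosing the change of variables for \<open>g\<close> reflected relative to
  that for \<open>f\<close>, the penalty \<open>L |x - y|\<^sup>\<delta>\<close> becomes a strictly
  superharmonic function of the common variable, by concavity of \<open>t\<^sup>\<delta>\<close>. On a small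
  sphere both functions are approximated by harmonic polynomials, and the classical maximum principle for
  polynomials gives the contradiction.\<close>

text \<open>The operator is singular at critical points and its coefficients depend on the gradient,
  so a linear comparison needs gradients that are nonzero and nearly constant. Doubling supplies the
  first: since the two points of the maximum are at distance at most 1, both gradients have norm at
  least \<open>L * \<delta> / 2\<close>. Sup-convolution supplies the second, at one fixed
  \<open>l\<close> with no passage to a limit: a touching test function has gradient
  \<open>2 * l\<close> times the displacement of a convolution maximizer, and maximizers are stable
  where they are unique. The two linear maps use the opposite square roots \<open>s\<close> and
  \<open>- s\<close> of \<open>p - 1\<close>. For a common axis \<open>e\<close> their difference
  sends \<open>z\<close> to \<open>(2 * s * (e \<bullet> z)) *\<^sub>R e\<close>, so the two points
  separate only along the line joining them, the direction in which the penalty is concave. Equal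
  roots would leave the distance unchanged and gain nothing. The gain is at least
  \<open>(1 - \<delta>) * (p - 1) * (L * \<delta>)\<close>, the localization costs at most
  \<open>2 * N * (n + p)\<close>, and \<open>L\<close> is chosen to make the gain prevail.\<close>

section \<open>Calculus of polynomial functions\<close>

text \<open>As introduction rules these have higher-order patterns on which \<open>auto\<close> and \<open>blast\<close> diverge.\<close>

declare real_polynomial_function.intros [rule del]
declare real_polynomial_function_minus [rule del] real_polynomial_function_diff [rule del]
  real_polynomial_function_divide [rule del] real_polynomial_function_sum [rule del]
  real_polynomial_function_prod [rule del] real_polynomial_function_power [rule del]
  real_polynomial_function_compose [rule del]

lemmas polynomial_linear = real_polynomial_function.intros(1)
  and polynomial_const = real_polynomial_function.intros(2)
  and polynomial_add = real_polynomial_function.intros(3)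
  and polynomial_mult = real_polynomial_function.intros(4)

lemma gradient_eqI:
  assumes "(f has_derivative (\<lambda>h. g \<bullet> h)) (at x)"
  shows "gradient f x = g"
  by (simp add: gradient_def vec_eq_iff inner_axis flip: frechet_derivative_at[OF assms])

text \<open>A first-order operator from scalar functions to scalar functions can be iterated, so
  second derivatives follow from the product rule by rewriting; \<open>polynomial_hessian\<close>
  links the iterates to \<open>hessian\<close>.\<close>

definition partial :: "'n \<Rightarrow> (real ^ 'n \<Rightarrow> real) \<Rightarrow> real ^ 'n \<Rightarrow> real" where
  "partial i f x = gradient f x $ i"

text \<open>The existential form lets the induction build a gradient together with the polynomiality
  of its components; only afterwards does \<open>gradient_eqI\<close> identify the witness with
  \<open>gradient\<close>.\<close>

lemma polynomial_gradient:
  fixes f :: "real ^ 'n \<Rightarrow> real"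
  assumes "real_polynomial_function f"
  shows "\<exists>g. (\<forall>x. (f has_derivative (\<lambda>h. g x \<bullet> h)) (at x)) \<and>
             (\<forall>i. real_polynomial_function (\<lambda>x. g x $ i))"
  using assms
proof induction
  case (linear f)
  then interpret bounded_linear f .
  have "(f has_derivative (\<lambda>h. (\<chi> i. f (axis i 1)) \<bullet> h)) (at x)" for x
  proof -
    have "f h = (\<chi> i. f (axis i 1)) \<bullet> h" for h
    proof -
      have "f h = f (\<Sum>i\<in>UNIV. h $ i *\<^sub>R axis i 1)"
        by (simp add: basis_expansion scalar_mult_eq_scaleR[symmetric])
      also have "\<dots> = (\<chi> i. f (axis i 1)) \<bullet> h"
        by (simp add: sum scaleR inner_vec_def mult_ac)
      finally show ?thesis .
    qed
    then show ?thesis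
      by (intro has_derivative_eq_rhs[OF bounded_linear_imp_has_derivative[OF bounded_linear_axioms]] ext)
  qed
  moreover have "real_polynomial_function (\<lambda>x. (\<chi> i. f (axis i 1)) $ i)" for i
    by (rule polynomial_const)
  ultimately show ?case
    by (intro exI[of _ "\<lambda>x. \<chi> i. f (axis i 1)"] conjI allI)
next
  case (const c)
  show ?case
  proof (intro exI[of _ "\<lambda>x. 0"] conjI allI)
    show "((\<lambda>x. c) has_derivative (\<lambda>h. 0 \<bullet> h)) (at x)" for x :: "real ^ 'n"
      by simp
    show "real_polynomial_function (\<lambda>x. 0 $ i)" for i :: 'n
      by (rule polynomial_const)
  qed
next
  case (add f g)
  then obtain F G where
    "\<And>x. (f has_derivative (\<lambda>h. F x \<bullet> h)) (at x)" "\<And>i. real_polynomial_function (\<lambda>x. F x $ i)"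
    "\<And>x. (g has_derivative (\<lambda>h. G x \<bullet> h)) (at x)" "\<And>i. real_polynomial_function (\<lambda>x. G x $ i)"
    by blast
  note FG = this
  show ?case
  proof (intro exI[of _ "\<lambda>x. F x + G x"] conjI allI)
    show "((\<lambda>x. f x + g x) has_derivative (\<lambda>h. (F x + G x) \<bullet> h)) (at x)" for x
      by (rule has_derivative_eq_rhs[OF has_derivative_add[OF FG(1,3)]])
        (auto simp: inner_add_left)
    show "real_polynomial_function (\<lambda>x. (F x + G x) $ i)" for i
      using polynomial_add[OF FG(2,4)] by simp
  qed
next
  case (mult f g)
  then obtain F G where FG:
    "\<And>x. (f has_derivative (\<lambda>h. F x \<bullet> h)) (at x)" "\<And>i. real_polynomial_function (\<lambda>x. F x $ i)"
    "\<And>x. (g has_derivative (\<lambda>h. G x \<bullet> h)) (at x)" "\<And>i. real_polynomial_function (\<lambda>x. G x $ i)"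
    by blast
  show ?case
  proof (intro exI[of _ "\<lambda>x. f x *\<^sub>R G x + g x *\<^sub>R F x"] conjI allI)
    show "((\<lambda>x. f x * g x) has_derivative (\<lambda>h. (f x *\<^sub>R G x + g x *\<^sub>R F x) \<bullet> h)) (at x)" for x
      by (rule has_derivative_eq_rhs[OF has_derivative_mult[OF FG(1,3)]])
        (auto simp: inner_add_left)
    show "real_polynomial_function (\<lambda>x. (f x *\<^sub>R G x + g x *\<^sub>R F x) $ i)" for i
      using polynomial_add[OF polynomial_mult[OF mult.hyps(1) FG(4)] polynomial_mult[OF mult.hyps(2) FG(2)]]
      by simp
  qed
qed

lemma polynomial_has_derivative:
  fixes f :: "real ^ 'n \<Rightarrow> real"
  assumes "real_polynomial_function f"
  shows "(f has_derivative (\<lambda>h. gradient f x \<bullet> h)) (at x)"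
  using polynomial_gradient[OF assms] gradient_eqI by metis

lemma polynomial_partial:
  fixes f :: "real ^ 'n \<Rightarrow> real"
  assumes "real_polynomial_function f"
  shows "real_polynomial_function (partial i f)"
proof -
  obtain g where g: "\<And>x. (f has_derivative (\<lambda>h. g x \<bullet> h)) (at x)"
    "\<And>i. real_polynomial_function (\<lambda>x. g x $ i)"
    using polynomial_gradient[OF assms] by blast
  have "partial i f = (\<lambda>x. g x $ i)"
    using gradient_eqI[OF g(1)] by (auto simp: partial_def)
  with g show ?thesis by simp
qed

lemma polynomial_continuous_on:
  fixes f :: "real ^ 'n \<Rightarrow> real"
  assumes "real_polynomial_function f"
  shows "continuous_on S f"
  by (intro continuous_at_imp_continuous_on ballI has_derivative_continuous[OF polynomial_has_derivative[OF assms]])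

lemma polynomial_gradient_differentiable:
  fixes f :: "real ^ 'n \<Rightarrow> real"
  assumes "real_polynomial_function f"
  shows "(gradient f has_derivative (\<lambda>h. \<chi> i. gradient (partial i f) x \<bullet> h)) (at x)"
proof -
  have "((\<lambda>x. \<chi> i. partial i f x) has_derivative (\<lambda>h. \<chi> i. gradient (partial i f) x \<bullet> h)) (at x)"
  proof (subst has_derivative_componentwise_within, rule ballI)
    fix b :: "real ^ 'n" assume "b \<in> Basis"
    then obtain i where b: "b = axis i 1" by (auto simp: Basis_vec_def)
    show "((\<lambda>x. (\<chi> i. partial i f x) \<bullet> b) has_derivative
        (\<lambda>h. (\<chi> i. gradient (partial i f) x \<bullet> h) \<bullet> b)) (at x)"
      using polynomial_has_derivative[OF polynomial_partial[OF assms], of i x]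
      by (simp add: b inner_axis)
  qed
  then show ?thesis by (simp add: partial_def fun_eq_iff)
qed

lemma polynomial_hessian:
  fixes f :: "real ^ 'n \<Rightarrow> real"
  assumes "real_polynomial_function f"
  shows "hessian f x $ i $ j = partial j (partial i f) x"
  unfolding hessian_def jacobian_def
  by (subst frechet_derivative_at[OF polynomial_gradient_differentiable[OF assms], symmetric])
    (simp add: matrix_def inner_axis partial_def)

lemma polynomial_hessian_mult:
  fixes f :: "real ^ 'n \<Rightarrow> real"
  assumes "real_polynomial_function f"
  shows "hessian f x *v h = (\<chi> i. gradient (partial i f) x \<bullet> h)"
  using assms by (simp add: matrix_vector_mult_def polynomial_hessian inner_vec_def partial_def)

lemma polynomial_C2_on:
  fixes f :: "real ^ 'n \<Rightarrow> real"
  assumes "real_polynomial_function f"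
  shows "C2_on U f"
proof -
  have "continuous_on U (\<lambda>x. \<chi> i j. hessian f x $ i $ j)"
    unfolding polynomial_hessian[OF assms]
    by (intro continuous_on_vec_lambda polynomial_continuous_on polynomial_partial assms)
  then have "continuous_on U (hessian f)" by simp
  then show ?thesis
    using differentiableI[OF polynomial_has_derivative[OF assms]]
      differentiableI[OF polynomial_gradient_differentiable[OF assms]]
    by (simp add: C2_on_def)
qed

lemma laplacian_polynomial:
  fixes f :: "real ^ 'n \<Rightarrow> real"
  assumes "real_polynomial_function f"
  shows "laplacian f x = (\<Sum>i\<in>UNIV. partial i (partial i f) x)"
  by (simp add: laplacian_def trace_def polynomial_hessian[OF assms])

lemma polynomial_laplacian:
  fixes f :: "real ^ 'n \<Rightarrow> real"
  assumes "real_polynomial_function f"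
  shows "real_polynomial_function (laplacian f)"
  unfolding laplacian_polynomial[OF assms, abs_def]
  by (intro real_polynomial_function_sum polynomial_partial assms finite)

lemma partial_const [simp]: "partial i (\<lambda>x :: real ^ 'n. c) = (\<lambda>x. 0)"
proof -
  have "gradient (\<lambda>x. c) x = 0" for x :: "real ^ 'n"
    by (rule gradient_eqI) simp
  then show ?thesis by (auto simp: partial_def)
qed

lemma partial_add:
  assumes "real_polynomial_function f" "real_polynomial_function g"
  shows "partial i (\<lambda>x. f x + g x) = (\<lambda>x. partial i f x + partial i g x)"
proof -
  have "gradient (\<lambda>x. f x + g x) x = gradient f x + gradient g x" for x
    by (intro gradient_eqI has_derivative_eq_rhs[OF has_derivative_add[OF assms[THEN polynomial_has_derivative]]])
      (auto simp: inner_add_left)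
  then show ?thesis by (simp add: partial_def fun_eq_iff)
qed

lemma partial_mult:
  assumes "real_polynomial_function f" "real_polynomial_function g"
  shows "partial i (\<lambda>x. f x * g x) = (\<lambda>x. f x * partial i g x + g x * partial i f x)"
proof -
  have "gradient (\<lambda>x. f x * g x) x = f x *\<^sub>R gradient g x + g x *\<^sub>R gradient f x" for x
    by (intro gradient_eqI has_derivative_eq_rhs[OF has_derivative_mult[OF assms[THEN polynomial_has_derivative]]])
      (auto simp: inner_add_left)
  then show ?thesis by (simp add: partial_def fun_eq_iff)
qed

lemma partial_cmult:
  assumes "real_polynomial_function f"
  shows "partial i (\<lambda>x. c * f x) = (\<lambda>x. c * partial i f x)"
  using partial_mult[OF polynomial_const assms] by simp

lemma partial_linear:
  assumes "bounded_linear f"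
  shows "partial i f = (\<lambda>x. f (axis i 1))"
proof -
  have "partial i f x = f (axis i 1)" for x
    using frechet_derivative_at[OF bounded_linear_imp_has_derivative[OF assms, of "at x"]]
    by (simp add: partial_def gradient_def)
  then show ?thesis by blast
qed

lemma partial_sum:
  assumes "finite A" "\<And>k. k \<in> A \<Longrightarrow> real_polynomial_function (f k)"
  shows "partial i (\<lambda>x. \<Sum>k\<in>A. f k x) = (\<lambda>x. \<Sum>k\<in>A. partial i (f k) x)"
  using assms
  by (induction A rule: finite_induct) (auto simp: partial_add real_polynomial_function_sum)

text \<open>Structural induction: linear functions have constant partial derivatives, and the twice
  applied product rule is symmetric in \<open>i\<close> and \<open>j\<close> once this holds for the
  factors.\<close>

lemma partial_commute:
  fixes f :: "real ^ 'n \<Rightarrow> real"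
  assumes "real_polynomial_function f"
  shows "partial i (partial j f) = partial j (partial i f)"
  using assms
proof induction
  case (linear f)
  then show ?case by (simp add: partial_linear)
next
  case (mult f g)
  then show ?case
    by (simp add: partial_mult partial_add polynomial_partial polynomial_mult algebra_simps)
qed (simp_all add: partial_add polynomial_partial)

lemma laplacian_add:
  assumes "real_polynomial_function f" "real_polynomial_function g"
  shows "laplacian (\<lambda>x. f x + g x) x = laplacian f x + laplacian g x"
  using assms
  by (simp add: laplacian_polynomial partial_add polynomial_partial polynomial_add sum.distrib)

lemma laplacian_mult:
  fixes f g :: "real ^ 'n \<Rightarrow> real"
  assumes "real_polynomial_function f" "real_polynomial_function g"
  shows "laplacian (\<lambda>x. f x * g x) x =
    f x * laplacian g x + g x * laplacian f x + 2 * (gradient f x \<bullet> gradient g x)"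
  using assms
  by (simp add: laplacian_polynomial partial_mult partial_add polynomial_partial polynomial_mult
      sum.distrib sum_distrib_left algebra_simps inner_vec_def partial_def[symmetric])

lemma laplacian_const [simp]: "laplacian (\<lambda>x :: real ^ 'n. c) x = 0"
  by (simp add: laplacian_polynomial polynomial_const)

lemma laplacian_cmult:
  assumes "real_polynomial_function f"
  shows "laplacian (\<lambda>x. c * f x) x = c * laplacian f x"
  using assms by (simp add: laplacian_polynomial partial_cmult polynomial_partial
      polynomial_mult polynomial_const sum_distrib_left)

lemma polynomial_component: "real_polynomial_function (\<lambda>x :: real ^ 'n. x $ i)"
  by (intro polynomial_linear bounded_linear_vec_nth)

lemma gradient_add:
  assumes "real_polynomial_function f" "real_polynomial_function g"
  shows "gradient (\<lambda>x. f x + g x) x = gradient f x + gradient g x"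
  using fun_cong[OF partial_add[OF assms]] by (simp add: vec_eq_iff partial_def)

lemma gradient_mult:
  assumes "real_polynomial_function f" "real_polynomial_function g"
  shows "gradient (\<lambda>x. f x * g x) x = f x *\<^sub>R gradient g x + g x *\<^sub>R gradient f x"
  using fun_cong[OF partial_mult[OF assms]] by (simp add: vec_eq_iff partial_def)

lemma gradient_cmult:
  assumes "real_polynomial_function f"
  shows "gradient (\<lambda>x. c * f x) x = c *\<^sub>R gradient f x"
  using fun_cong[OF partial_cmult[OF assms]] by (simp add: vec_eq_iff partial_def)

lemma gradient_const [simp]: "gradient (\<lambda>x :: real ^ 'n. c) x = 0"
  by (rule gradient_eqI) simp

lemma gradient_component: "gradient (\<lambda>x :: real ^ 'n. x $ i) x = axis i 1"
  by (rule gradient_eqI, rule has_derivative_eq_rhs[OF bounded_linear_imp_has_derivative[OF bounded_linear_vec_nth]])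
    (simp add: inner_axis' fun_eq_iff)

lemma laplacian_affine:
  assumes "bounded_linear f"
  shows "laplacian (\<lambda>x :: real ^ 'n. f x + c) x = 0"
  using assms by (simp add: laplacian_polynomial partial_add partial_linear polynomial_linear
      polynomial_const polynomial_add)

lemma laplacian_component: "laplacian (\<lambda>x :: real ^ 'n. x $ i) x = 0"
  using laplacian_affine[OF bounded_linear_vec_nth, of _ 0] by simp

lemma laplacian_sum:
  assumes "finite A" "\<And>k. k \<in> A \<Longrightarrow> real_polynomial_function (f k)"
  shows "laplacian (\<lambda>x :: real ^ 'n. \<Sum>k\<in>A. f k x) x = (\<Sum>k\<in>A. laplacian (f k) x)"
  using assms
  by (induction A rule: finite_induct) (auto simp: laplacian_add real_polynomial_function_sum)

lemma gradient_sum: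
  assumes "finite A" "\<And>k. k \<in> A \<Longrightarrow> real_polynomial_function (f k)"
  shows "gradient (\<lambda>x :: real ^ 'n. \<Sum>k\<in>A. f k x) x = (\<Sum>k\<in>A. gradient (f k) x)"
  using assms
  by (induction A rule: finite_induct) (auto simp: gradient_add real_polynomial_function_sum)

lemma polynomial_norm_power2: "real_polynomial_function (\<lambda>x :: real ^ 'n. (norm x)\<^sup>2)"
  unfolding power2_norm_eq_inner inner_vec_def inner_real_def
  by (intro real_polynomial_function_sum finite polynomial_mult polynomial_component)

lemma gradient_norm_power2: "gradient (\<lambda>x :: real ^ 'n. (norm x)\<^sup>2) x = 2 *\<^sub>R x"
proof -
  have "gradient (\<lambda>x :: real ^ 'n. \<Sum>i\<in>UNIV. x $ i * x $ i) x = 2 *\<^sub>R x"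
    by (simp add: gradient_sum gradient_mult polynomial_mult polynomial_component gradient_component
        vec_eq_iff axis_def if_distrib[of "\<lambda>y. _ * y"] cong: if_cong)
  then show ?thesis by (simp add: power2_norm_eq_inner inner_vec_def)
qed

lemma laplacian_norm_power2: "laplacian (\<lambda>x :: real ^ 'n. (norm x)\<^sup>2) x = 2 * real CARD('n)"
proof -
  have "laplacian (\<lambda>x :: real ^ 'n. \<Sum>i\<in>UNIV. x $ i * x $ i) x = 2 * real CARD('n)"
    by (simp add: laplacian_sum laplacian_mult polynomial_mult polynomial_component gradient_component
        laplacian_component inner_axis)
  then show ?thesis by (simp add: power2_norm_eq_inner inner_vec_def)
qed

lemma laplacian_partial:
  assumes "real_polynomial_function f"
  shows "laplacian (partial i f) x = partial i (laplacian f) x"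
proof -
  have "partial i (laplacian f) x = (\<Sum>k\<in>UNIV. partial i (partial k (partial k f)) x)"
    unfolding laplacian_polynomial[OF assms, abs_def]
    by (subst partial_sum) (auto intro!: polynomial_partial assms)
  also have "\<dots> = (\<Sum>k\<in>UNIV. partial k (partial k (partial i f)) x)"
    using assms by (simp add: partial_commute polynomial_partial)
  finally show ?thesis by (simp add: laplacian_polynomial polynomial_partial assms)
qed

section \<open>Extremum conditions along lines and the maximum principle\<close>

lemma DERIV_along_line:
  assumes "real_polynomial_function f"
  shows "((\<lambda>t. f (x + t *\<^sub>R v)) has_real_derivative gradient f (x + t *\<^sub>R v) \<bullet> v) (at t)"
proof -
  have "((\<lambda>t. x + t *\<^sub>R v) has_derivative (\<lambda>t. t *\<^sub>R v)) (at t)"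
    by (auto intro!: derivative_eq_intros)
  from diff_chain_at[OF this polynomial_has_derivative[OF assms]]
  show ?thesis by (simp add: o_def has_field_derivative_def mult_commute_abs)
qed

lemma DERIV2_along_line:
  assumes "real_polynomial_function f"
  shows "((\<lambda>t. gradient f (x + t *\<^sub>R v) \<bullet> v) has_real_derivative
    (hessian f (x + t *\<^sub>R v) *v v) \<bullet> v) (at t)"
proof -
  have "((\<lambda>t. x + t *\<^sub>R v) has_derivative (\<lambda>t. t *\<^sub>R v)) (at t)"
    by (auto intro!: derivative_eq_intros)
  from diff_chain_at[OF this polynomial_gradient_differentiable[OF assms]]
  have "((\<lambda>t. gradient f (x + t *\<^sub>R v)) has_derivative (\<lambda>s. hessian f (x + t *\<^sub>R v) *v (s *\<^sub>R v))) (at t)"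
    by (simp add: o_def polynomial_hessian_mult[OF assms])
  from has_derivative_inner_left[OF this, of v]
  show ?thesis by (simp add: has_field_derivative_def mult_commute_abs matrix_vector_mult_scaleR)
qed

lemma gradient_zero_at_local_min:
  assumes "real_polynomial_function f" "local_min_at f x"
  shows "gradient f x = 0"
proof -
  obtain d where d: "d > 0" "\<And>y. dist y x < d \<Longrightarrow> f x \<le> f y"
    using assms(2) by (auto simp: local_min_at_def eventually_nhds_metric)
  have "(\<lambda>h. gradient f x \<bullet> h) = (\<lambda>v. 0)"
    by (rule differential_zero_maxmin[OF _ open_ball[of x d] polynomial_has_derivative[OF assms(1)]])
      (use d in \<open>auto simp: dist_commute\<close>)
  then have "gradient f x \<bullet> gradient f x = 0" by metis
  then show ?thesis by simp
qed

text \<open>The derivative along \<open>v\<close> vanishes at \<open>x\<close>. If the second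
  derivative were negative, the first would be negative just to the right of 0, and the mean value
  theorem would give a value below the minimum.\<close>

lemma hessian_nonneg_at_local_min:
  assumes "real_polynomial_function f" "local_min_at f x"
  shows "(hessian f x *v v) \<bullet> v \<ge> 0"
proof (rule ccontr)
  assume neg: "\<not> (hessian f x *v v) \<bullet> v \<ge> 0"
  obtain d where d: "d > 0" "\<And>y. dist y x < d \<Longrightarrow> f x \<le> f y"
    using assms(2) by (auto simp: local_min_at_def eventually_nhds_metric)
  have D1: "((\<lambda>t. f (x + t *\<^sub>R v)) has_real_derivative gradient f (x + t *\<^sub>R v) \<bullet> v) (at t)" for t
    by (rule DERIV_along_line[OF assms(1)])
  have g0: "gradient f x = 0" by (rule gradient_zero_at_local_min[OF assms])
  have "((\<lambda>t. gradient f (x + t *\<^sub>R v) \<bullet> v) has_real_derivative (hessian f x *v v) \<bullet> v) (at 0)"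
    using DERIV2_along_line[OF assms(1), of x v 0] by simp
  then obtain e where e: "e > 0" "\<And>h. 0 < h \<Longrightarrow> h < e \<Longrightarrow> gradient f (x + h *\<^sub>R v) \<bullet> v < 0"
    using DERIV_neg_dec_right[of "\<lambda>t. gradient f (x + t *\<^sub>R v) \<bullet> v" _ 0] neg g0
    by (simp add: not_le) metis
  \<comment> \<open>The summand 1 in the denominator keeps it positive when \<open>v = 0\<close>;
    the bound yields \<open>h * norm v < d\<close>.\<close>
  define h where "h = min (e/2) (d / (2 * (norm v + 1)))"
  have h: "h > 0" "h < e" using d e by (auto simp: h_def add_nonneg_pos)
  have "h * norm v < d"
  proof -
    have "h * norm v \<le> d / (2 * (norm v + 1)) * norm v"
      by (intro mult_right_mono) (auto simp: h_def)
    also have "\<dots> = d * (norm v / (2 * (norm v + 1)))" by simp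
    also have "\<dots> < d * 1"
      using d by (intro mult_strict_left_mono) (auto simp: divide_less_eq add_nonneg_pos)
    also have "d * 1 = d" by simp
    finally show ?thesis .
  qed
  then have "f x \<le> f (x + h *\<^sub>R v)" using h by (intro d) (simp add: dist_norm)
  moreover obtain t where "0 < t" "t < h" "f (x + h *\<^sub>R v) - f (x + 0 *\<^sub>R v) = (h - 0) * (gradient f (x + t *\<^sub>R v) \<bullet> v)"
    using MVT2[OF h(1) D1] by metis
  moreover have "h * (gradient f (x + t *\<^sub>R v) \<bullet> v) < 0"
    using e(2)[of t] calculation h by (intro mult_pos_neg) auto
  ultimately show False by simp
qed

lemma laplacian_nonneg_at_local_min:
  assumes "real_polynomial_function f" "local_min_at f x"
  shows "laplacian f x \<ge> 0"
proof -
  have "hessian f x $ i $ i = (hessian f x *v axis i 1) \<bullet> axis i 1" for i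
    by (simp add: inner_axis matrix_vector_mul_component)
  then show ?thesis
    using hessian_nonneg_at_local_min[OF assms]
    unfolding laplacian_def trace_def by (auto intro!: sum_nonneg)
qed

text \<open>A positive maximum cannot lie on the sphere, and at an interior one the Laplacian would
  be at most 0, against the strict inequality in \<open>lap\<close>.\<close>

lemma subharmonic_max_principle:
  fixes f :: "real ^ 'n \<Rightarrow> real"
  assumes f: "real_polynomial_function f" and "r > 0"
    and lap: "\<And>x. norm x < r \<Longrightarrow> laplacian f x > 0"
    and bd: "\<And>x. norm x = r \<Longrightarrow> f x \<le> 0" and x: "norm x \<le> r"
  shows "f x \<le> 0"
proof (rule ccontr)
  assume "\<not> f x \<le> 0"
  obtain m where m: "m \<in> cball 0 r" "\<And>y. y \<in> cball 0 r \<Longrightarrow> f y \<le> f m"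
    using continuous_attains_sup[OF compact_cball _ polynomial_continuous_on[OF f]] \<open>r > 0\<close>
    by (metis cball_eq_empty less_le_not_le)
  have "f m > 0" using m(2)[of x] x \<open>\<not> f x \<le> 0\<close> by auto
  with bd[of m] m have *: "norm m < r" by fastforce
  have "\<forall>\<^sub>F y in nhds m. y \<in> ball 0 r" using * by (intro eventually_nhds_in_open) auto
  then have "local_min_at (\<lambda>x. (-1) * f x) m"
    unfolding local_min_at_def by eventually_elim (use m in auto)
  then have "laplacian (\<lambda>x. (-1) * f x) m \<ge> 0"
    by (intro laplacian_nonneg_at_local_min polynomial_mult polynomial_const f)
  then show False using lap[OF *] laplacian_cmult[OF f, of "-1" m] by simp
qed

section \<open>Hessians under affine changes of variables\<close>

lemma hessian_mult_eqI:
  fixes f :: "real ^ 'n \<Rightarrow> real"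
  assumes "(gradient f has_derivative D) (at x)"
  shows "hessian f x *v v = D v"
proof -
  have "(gradient f has_derivative (\<lambda>v. hessian f x *v v)) (at x)"
    using assms jacobian_works[of "gradient f" "at x"] unfolding hessian_def differentiable_def by blast
  from has_derivative_unique[OF this assms] show ?thesis by metis
qed

lemma laplacian_eq_sum_forms:
  "laplacian f x = (\<Sum>i\<in>UNIV. (hessian f x *v axis i 1) \<bullet> axis i 1)"
  by (simp add: laplacian_def trace_def inner_axis matrix_vector_mul_component)

lemma polynomial_affine:
  fixes S :: "real ^ 'n \<Rightarrow> real ^ 'n"
  assumes "real_polynomial_function h" "bounded_linear S"
  shows "real_polynomial_function (\<lambda>z. h (S z + c))"
proof -
  have "polynomial_function (\<lambda>z. S z + c)"
    by (intro polynomial_function_add polynomial_function_bounded_linear assms polynomial_function_const)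
  from real_polynomial_function_compose[OF this assms(1)] show ?thesis by (simp add: o_def)
qed

lemma gradient_affine:
  fixes S :: "real ^ 'n \<Rightarrow> real ^ 'n"
  assumes "real_polynomial_function h" "bounded_linear S"
  shows "gradient (\<lambda>z. h (S z + c)) z \<bullet> v = gradient h (S z + c) \<bullet> S v"
proof -
  have "((\<lambda>z. S z + c) has_derivative S) (at z)"
    using bounded_linear_imp_has_derivative[OF assms(2)] by (auto intro!: derivative_eq_intros)
  from diff_chain_at[OF this polynomial_has_derivative[OF assms(1)]]
  have "((\<lambda>z. h (S z + c)) has_derivative (\<lambda>v. gradient h (S z + c) \<bullet> S v)) (at z)"
    by (simp add: o_def)
  from has_derivative_unique[OF polynomial_has_derivative[OF polynomial_affine[OF assms]] this]
  show ?thesis by metis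
qed

lemma hessian_affine:
  fixes S :: "real ^ 'n \<Rightarrow> real ^ 'n"
  assumes "real_polynomial_function h" "bounded_linear S"
  shows "(hessian (\<lambda>z. h (S z + c)) z *v v) \<bullet> w = (hessian h (S z + c) *v S v) \<bullet> S w"
proof -
  let ?g = "\<lambda>z. h (S z + c)"
  have "((\<lambda>z. S z + c) has_derivative S) (at z)"
    using bounded_linear_imp_has_derivative[OF assms(2)] by (auto intro!: derivative_eq_intros)
  from diff_chain_at[OF this polynomial_gradient_differentiable[OF assms(1)]]
  have "((\<lambda>z. gradient h (S z + c)) has_derivative (\<lambda>v. hessian h (S z + c) *v S v)) (at z)"
    by (simp add: o_def polynomial_hessian_mult[OF assms(1)])
  from has_derivative_inner_left[OF this, of "S w"]
  have 1: "((\<lambda>z. gradient ?g z \<bullet> w) has_derivative (\<lambda>v. (hessian h (S z + c) *v S v) \<bullet> S w)) (at z)"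
    by (simp add: gradient_affine[OF assms])
  have "((\<lambda>z. gradient ?g z) has_derivative (\<lambda>v. hessian ?g z *v v)) (at z)"
    using polynomial_gradient_differentiable[OF polynomial_affine[OF assms]]
    by (simp add: polynomial_hessian_mult[OF polynomial_affine[OF assms]])
  from has_derivative_unique[OF has_derivative_inner_left[OF this, of w] 1]
  show ?thesis by metis
qed

lemma gradient_dist_power2:
  "gradient (\<lambda>x :: real ^ 'n. c * (norm (x - z))\<^sup>2) = (\<lambda>x. (2 * c) *\<^sub>R (x - z))"
proof
  fix x :: "real ^ 'n"
  show "gradient (\<lambda>x. c * (norm (x - z))\<^sup>2) x = (2 * c) *\<^sub>R (x - z)"
    unfolding power2_norm_eq_inner
    by (rule gradient_eqI) (auto intro!: derivative_eq_intros simp: fun_eq_iff inner_commute algebra_simps)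
qed

lemma hessian_dist_power2:
  "hessian (\<lambda>x :: real ^ 'n. c * (norm (x - z))\<^sup>2) x *v v = (2 * c) *\<^sub>R v"
  by (rule hessian_mult_eqI, unfold gradient_dist_power2) (auto intro!: derivative_eq_intros)

lemma polynomial_dist_power2: "real_polynomial_function (\<lambda>x :: real ^ 'n. c * (norm (x - z))\<^sup>2)"
  using polynomial_mult[OF polynomial_const polynomial_affine[OF polynomial_norm_power2 bounded_linear_ident, of "- z"]]
  by simp

lemma hessian_add:
  assumes "real_polynomial_function f" "real_polynomial_function g"
  shows "hessian (\<lambda>x. f x + g x) x = hessian f x + hessian g x"
  using assms by (simp add: vec_eq_iff polynomial_hessian partial_add polynomial_add polynomial_partial)

section \<open>Harmonic polynomials on spheres\<close>

text \<open>Homogeneity is encoded by Euler's identity, which can itself be differentiated with the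
  calculus above. The zero function has every degree.\<close>

definition homogeneous_harmonic :: "nat \<Rightarrow> (real ^ 'n \<Rightarrow> real) \<Rightarrow> bool" where
  "homogeneous_harmonic k h \<longleftrightarrow> real_polynomial_function h \<and> (\<forall>x. laplacian h x = 0) \<and>
     (\<forall>x. gradient h x \<bullet> x = real k * h x)"

lemma homogeneous_harmonic_const: "homogeneous_harmonic 0 (\<lambda>x. c)"
  by (simp add: homogeneous_harmonic_def polynomial_const)

lemma homogeneous_harmonic_cmult:
  "homogeneous_harmonic k h \<Longrightarrow> homogeneous_harmonic k (\<lambda>x. c * h x)"
  by (simp add: homogeneous_harmonic_def polynomial_const polynomial_mult laplacian_cmult gradient_cmult)

text \<open>Euler's identity in degree 0 says that the derivative along every ray from the origin
  vanishes, so \<open>h\<close> is constant.\<close>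

lemma homogeneous_harmonic_0_gradient:
  assumes "homogeneous_harmonic 0 h"
  shows "gradient h x = 0"
proof -
  have p: "real_polynomial_function h" and e: "\<And>x. gradient h x \<bullet> x = 0"
    using assms by (auto simp: homogeneous_harmonic_def)
  have "h y = h 0" for y
  proof -
    obtain t where t: "0 < t" "t < (1::real)"
      "h (0 + 1 *\<^sub>R y) - h (0 + 0 *\<^sub>R y) = (1 - 0) * (gradient h (0 + t *\<^sub>R y) \<bullet> y)"
      using MVT2[OF zero_less_one DERIV_along_line[OF p, of 0 y]] by metis
    have "t * (gradient h (t *\<^sub>R y) \<bullet> y) = 0" using e[of "t *\<^sub>R y"] by simp
    with t show ?thesis by simp
  qed
  then have "h = (\<lambda>x. h 0)" by blast
  then show ?thesis by (metis gradient_const)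
qed

text \<open>Differentiating Euler's identity in direction \<open>i\<close> also differentiates the
  factor \<open>x $ i\<close>; this contributes one copy of \<open>partial i h\<close>, which lowers
  the degree by one.\<close>

lemma homogeneous_harmonic_partial:
  assumes "homogeneous_harmonic (Suc k) h"
  shows "homogeneous_harmonic k (partial i h)"
  unfolding homogeneous_harmonic_def
proof (intro conjI allI)
  have p: "real_polynomial_function h" and l: "laplacian h = (\<lambda>x. 0)"
    and e: "(\<lambda>x. \<Sum>j\<in>UNIV. partial j h x * x $ j) = (\<lambda>x. real (Suc k) * h x)"
    using assms by (auto simp: homogeneous_harmonic_def inner_vec_def partial_def)
  show "real_polynomial_function (partial i h)" by (rule polynomial_partial[OF p])
  show "laplacian (partial i h) x = 0" for x
    by (simp add: laplacian_partial[OF p] l)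
  show "gradient (partial i h) x \<bullet> x = real k * partial i h x" for x
  proof -
    have pc: "partial i (\<lambda>x :: real ^ 'a. x $ j) = (\<lambda>x. if i = j then 1 else 0)" for j
      using bounded_linear_vec_nth by (subst partial_linear) (auto simp: axis_def)
    have "partial i (\<lambda>x. \<Sum>j\<in>UNIV. partial j h x * x $ j) x =
        (\<Sum>j\<in>UNIV. partial i (partial j h) x * x $ j) + partial i h x"
      by (simp add: partial_sum polynomial_mult polynomial_partial p polynomial_component partial_mult pc
          sum.distrib if_distrib[of "\<lambda>y. _ * y"] mult.commute cong: if_cong)
    also have "(\<Sum>j\<in>UNIV. partial i (partial j h) x * x $ j) = gradient (partial i h) x \<bullet> x"
      by (simp add: partial_commute[OF p, of i] inner_vec_def) (simp add: partial_def)
    finally have "partial i (\<lambda>x. real (Suc k) * h x) x = gradient (partial i h) x \<bullet> x + partial i h x"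
      unfolding e .
    then show ?thesis unfolding partial_cmult[OF p] by (simp add: algebra_simps)
  qed
qed

lemma gradient_inner_axis: "gradient f x \<bullet> axis i 1 = partial i f x"
  by (simp add: inner_axis partial_def)

text \<open>If \<open>h\<close> is harmonic and homogeneous of degree \<open>k + 1\<close> then \<open>\<Delta>(x\<^sub>i h) = 2 \<partial>\<^sub>i h\<close> and
  \<open>\<Delta>(|x|\<^sup>2 \<partial>\<^sub>i h) = (2n + 4k) \<partial>\<^sub>i h\<close>, so a multiple of \<open>|x|\<^sup>2 \<partial>\<^sub>i h\<close>, which on a sphere is a
  multiple of the harmonic \<open>\<partial>\<^sub>i h\<close>, corrects \<open>x\<^sub>i h\<close> to a harmonic polynomial.\<close>

lemma homogeneous_harmonic_mult_component:
  fixes h :: "real ^ 'n \<Rightarrow> real"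
  assumes h: "homogeneous_harmonic (Suc k) h"
  defines "c \<equiv> 1 / (real CARD('n) + 2 * real k)"
  shows "homogeneous_harmonic (Suc (Suc k)) (\<lambda>x. x $ i * h x + (- c) * ((norm x)\<^sup>2 * partial i h x))"
proof -
  have p: "real_polynomial_function h" and l: "\<And>x. laplacian h x = 0"
    and e: "\<And>x. gradient h x \<bullet> x = real (Suc k) * h x"
    using h by (auto simp: homogeneous_harmonic_def)
  have p': "real_polynomial_function (partial i h)" and l': "\<And>x. laplacian (partial i h) x = 0"
    and e': "\<And>x. gradient (partial i h) x \<bullet> x = real k * partial i h x"
    using homogeneous_harmonic_partial[OF h, of i] by (auto simp: homogeneous_harmonic_def)
  note P = polynomial_component polynomial_norm_power2 polynomial_add polynomial_mult polynomial_const p p'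
  have c: "c * (2 * real CARD('n) + 4 * real k) = 2"
  proof -
    have "real CARD('n) + 2 * real k > 0" by (simp add: add_pos_nonneg)
    then show ?thesis by (simp add: c_def field_simps)
  qed
  have "laplacian (\<lambda>x. x $ i * h x + (- c) * ((norm x)\<^sup>2 * partial i h x)) x = 0" for x
  proof -
    have 1: "laplacian (\<lambda>x. x $ i * h x) x = 2 * partial i h x"
      by (simp add: laplacian_mult P l laplacian_component gradient_component gradient_inner_axis
          inner_commute[of "axis i 1"])
    have 2: "laplacian (\<lambda>x. (norm x)\<^sup>2 * partial i h x) x = (2 * real CARD('n) + 4 * real k) * partial i h x"
      by (simp add: laplacian_mult P l' laplacian_norm_power2 gradient_norm_power2
          inner_commute[of x] e' algebra_simps)
    show ?thesis
      unfolding laplacian_add[OF P(4)[OF P(1) p] P(4)[OF P(5) P(4)[OF P(2) p']]]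
        laplacian_cmult[OF P(4)[OF P(2) p']] 1 2
      by (simp only: mult_minus_left mult.assoc[symmetric, of c] c)
  qed
  moreover have "gradient (\<lambda>x. x $ i * h x + (- c) * ((norm x)\<^sup>2 * partial i h x)) x \<bullet> x =
      real (Suc (Suc k)) * (x $ i * h x + (- c) * ((norm x)\<^sup>2 * partial i h x))" for x
    unfolding gradient_add[OF P(4)[OF P(1) p] P(4)[OF P(5) P(4)[OF P(2) p']]]
        gradient_cmult[OF P(4)[OF P(2) p']] gradient_mult[OF P(1) p] gradient_mult[OF P(2) p']
        gradient_component gradient_norm_power2
    by (simp add: inner_add_left e e' inner_axis' power2_norm_eq_inner algebra_simps)
  ultimately show ?thesis
    unfolding homogeneous_harmonic_def by (intro conjI allI P)
qed

text \<open>In degree 0 the gradient of \<open>h\<close> vanishes, so the cross term in the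
  Laplacian of the product is zero and no correction is subtracted.\<close>

lemma homogeneous_harmonic_component_0:
  assumes h: "homogeneous_harmonic 0 h"
  shows "homogeneous_harmonic (Suc 0) (\<lambda>x. x $ i * h x)"
proof -
  have p: "real_polynomial_function h" and l: "\<And>x. laplacian h x = 0"
    using h by (auto simp: homogeneous_harmonic_def)
  then show ?thesis
    using homogeneous_harmonic_0_gradient[OF h]
    by (simp add: homogeneous_harmonic_def polynomial_mult polynomial_component laplacian_mult
        gradient_mult laplacian_component gradient_component inner_axis')
qed

text \<open>Degrees must be mixed: on a sphere, a coordinate times a homogeneous harmonic polynomial
  of degree \<open>k + 1\<close> has parts of degrees \<open>k + 2\<close> and
  \<open>k\<close>.\<close>

inductive harmonic_sum :: "(real ^ 'n \<Rightarrow> real) \<Rightarrow> bool" where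
  base: "homogeneous_harmonic k h \<Longrightarrow> harmonic_sum h"
| add: "harmonic_sum f \<Longrightarrow> harmonic_sum g \<Longrightarrow> harmonic_sum (\<lambda>x. f x + g x)"

lemma harmonic_sum_cmult: "harmonic_sum h \<Longrightarrow> harmonic_sum (\<lambda>x. c * h x)"
proof (induction rule: harmonic_sum.induct)
  case (add f g)
  then show ?case using harmonic_sum.add[OF add.IH] by (simp add: distrib_left)
qed (metis harmonic_sum.base homogeneous_harmonic_cmult)

lemma harmonic_sum_harmonic:
  "harmonic_sum h \<Longrightarrow> real_polynomial_function h \<and> (\<forall>x. laplacian h x = 0)"
  by (induction rule: harmonic_sum.induct)
    (auto simp: homogeneous_harmonic_def polynomial_add laplacian_add)

lemma harmonic_sum_mult_component:
  assumes "harmonic_sum h"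
  shows "\<exists>h'. harmonic_sum h' \<and> (\<forall>x. norm x = r \<longrightarrow> x $ i * h x = h' x)"
  using assms
proof induction
  case (base k h)
  show ?case
  proof (cases k)
    case 0
    then show ?thesis
      using harmonic_sum.base homogeneous_harmonic_component_0 base by blast
  next
    case (Suc j)
    define c where "c = 1 / (real CARD('a) + 2 * real j)"
    have "harmonic_sum (\<lambda>x. x $ i * h x + (- c) * ((norm x)\<^sup>2 * partial i h x))"
      using harmonic_sum.base[OF homogeneous_harmonic_mult_component[of j h i]] base
      unfolding Suc c_def by blast
    moreover have "harmonic_sum (\<lambda>x. (c * r\<^sup>2) * partial i h x)"
      using base unfolding Suc
      by (intro harmonic_sum_cmult harmonic_sum.base homogeneous_harmonic_partial)
    ultimately have "harmonic_sum (\<lambda>x. (x $ i * h x + (- c) * ((norm x)\<^sup>2 * partial i h x)) +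
        (c * r\<^sup>2) * partial i h x)"
      by (rule harmonic_sum.add)
    then show ?thesis
      by (intro exI[of _ "\<lambda>x. (x $ i * h x + (- c) * ((norm x)\<^sup>2 * partial i h x)) +
        (c * r\<^sup>2) * partial i h x"] conjI) simp_all
  qed
next
  case (add f g)
  then obtain f' g' where "harmonic_sum f'" "harmonic_sum g'"
    "\<forall>x. norm x = r \<longrightarrow> x $ i * f x = f' x" "\<forall>x. norm x = r \<longrightarrow> x $ i * g x = g' x" by blast
  then show ?case
    by (intro exI[of _ "\<lambda>x. f' x + g' x"] conjI harmonic_sum.add) (simp_all add: distrib_left)
qed

text \<open>With \<open>h = 1\<close> every polynomial is seen to agree on the sphere with a
  harmonic one. The general factor \<open>h\<close> is what lets the product case apply its two
  induction hypotheses one after the other.\<close>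

lemma harmonic_sum_mult_polynomial:
  assumes "real_polynomial_function p" "harmonic_sum h"
  shows "\<exists>h'. harmonic_sum h' \<and> (\<forall>x. norm x = r \<longrightarrow> p x * h x = h' x)"
  using assms
proof (induction arbitrary: h)
  case (linear f)
  have *: "\<exists>h'. harmonic_sum h' \<and> (\<forall>x. norm x = r \<longrightarrow> (\<Sum>i\<in>A. x $ i * f (axis i 1)) * h x = h' x)"
    if "finite A" for A :: "'a set"
    using that
  proof (induction A rule: finite_induct)
    case empty
    have "harmonic_sum (\<lambda>x. 0)" using harmonic_sum.base homogeneous_harmonic_const by blast
    then show ?case by (intro exI[of _ "\<lambda>x. 0"]) auto
  next
    case (insert i A)
    then obtain h1 where h1: "harmonic_sum h1"
      "\<forall>x. norm x = r \<longrightarrow> (\<Sum>i\<in>A. x $ i * f (axis i 1)) * h x = h1 x" by blast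
    obtain h2 where h2: "harmonic_sum h2" "\<forall>x. norm x = r \<longrightarrow> x $ i * h x = h2 x"
      using harmonic_sum_mult_component[OF linear.prems] by blast
    have "harmonic_sum (\<lambda>x. f (axis i 1) * h2 x + h1 x)"
      by (intro harmonic_sum.add harmonic_sum_cmult h1 h2)
    moreover have "(\<Sum>i\<in>insert i A. x $ i * f (axis i 1)) * h x = f (axis i 1) * h2 x + h1 x"
      if "norm x = r" for x
      using h1(2)[rule_format, OF that] h2(2)[rule_format, OF that] insert.hyps
      by (simp add: algebra_simps)
    ultimately show ?case by (intro exI[of _ "\<lambda>x. f (axis i 1) * h2 x + h1 x"]) blast
  qed
  interpret bounded_linear f by fact
  have "f = (\<lambda>x. \<Sum>i\<in>UNIV. x $ i * f (axis i 1))"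
  proof
    fix x
    have "f x = f (\<Sum>i\<in>UNIV. x $ i *\<^sub>R axis i 1)"
      by (simp add: basis_expansion scalar_mult_eq_scaleR[symmetric])
    then show "f x = (\<Sum>i\<in>UNIV. x $ i * f (axis i 1))" by (simp add: sum scaleR)
  qed
  then show ?case by (subst (1) \<open>f = _\<close>) (rule *[OF finite])
next
  case (const c)
  then show ?case using harmonic_sum_cmult by blast
next
  case (add f g)
  then obtain f' g' where "harmonic_sum f'" "harmonic_sum g'"
    "\<forall>x. norm x = r \<longrightarrow> f x * h x = f' x" "\<forall>x. norm x = r \<longrightarrow> g x * h x = g' x" by metis
  then show ?case
    by (intro exI[of _ "\<lambda>x. f' x + g' x"] conjI harmonic_sum.add) (simp_all add: distrib_right)
next
  case (mult f g)
  obtain g' where g': "harmonic_sum g'" "\<forall>x. norm x = r \<longrightarrow> g x * h x = g' x"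
    using mult.IH(2)[OF mult.prems] by blast
  obtain f' where f': "harmonic_sum f'" "\<forall>x. norm x = r \<longrightarrow> f x * g' x = f' x"
    using mult.IH(1)[OF g'(1)] by blast
  show ?case using f' g' by (intro exI[of _ f']) (simp add: mult.assoc)
qed

lemma harmonic_approximation_sphere:
  fixes f :: "real ^ 'n \<Rightarrow> real"
  assumes "continuous_on (sphere 0 r) f" "e > 0"
  obtains h where "real_polynomial_function h" "\<And>x. laplacian h x = 0"
    "\<And>x. norm x = r \<Longrightarrow> f x \<le> h x \<and> h x \<le> f x + e"
proof -
  \<comment> \<open>Approximating \<open>f + e/2\<close> within \<open>e/2\<close> turns a two-sided
    approximation into one from above, the side on which a comparison function must lie.\<close>
  have "continuous_on (sphere 0 r) (\<lambda>x. f x + e/2)" "0 < e/2"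
    using assms by (auto intro: continuous_intros)
  from Stone_Weierstrass_real_polynomial_function[OF compact_sphere this]
  obtain p where p: "real_polynomial_function p" "\<And>x. x \<in> sphere 0 r \<Longrightarrow> \<bar>f x + e/2 - p x\<bar> < e/2"
    by blast
  have "harmonic_sum (\<lambda>x :: real ^ 'n. 1)" using harmonic_sum.base homogeneous_harmonic_const by blast
  from harmonic_sum_mult_polynomial[OF p(1) this, of r]
  obtain h where h: "harmonic_sum h" "\<And>x. norm x = r \<Longrightarrow> p x = h x" by auto
  show thesis
  proof (rule that[of h])
    fix x :: "real ^ 'n" assume x: "norm x = r"
    then have "x \<in> sphere 0 r" by simp
    from p(2)[OF this] show "f x \<le> h x \<and> h x \<le> f x + e"
      unfolding h(2)[OF x] by linarith
  qed (use harmonic_sum_harmonic[OF h(1)] in auto)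
qed

section \<open>Sup-convolutions\<close>

text \<open>The customary parameter \<open>\<epsilon>\<close> is \<open>1 / (2 * l)\<close>, so a
  small parameter means a large \<open>l\<close>. The supremum is restricted to the closed ball,
  where a continuous \<open>u\<close> makes it attained for every \<open>x\<close>.\<close>

definition sup_convolution :: "real \<Rightarrow> (real ^ 'n \<Rightarrow> real) \<Rightarrow> real ^ 'n \<Rightarrow> real" where
  "sup_convolution l u x = (SUP z\<in>cball 0 1. u z - l * (norm (x - z))\<^sup>2)"

definition sup_maximizer :: "real \<Rightarrow> (real ^ 'n \<Rightarrow> real) \<Rightarrow> real ^ 'n \<Rightarrow> real ^ 'n \<Rightarrow> bool" where
  "sup_maximizer l u x z \<longleftrightarrow> z \<in> cball 0 1 \<and>
     (\<forall>w\<in>cball 0 1. u w - l * (norm (x - w))\<^sup>2 \<le> u z - l * (norm (x - z))\<^sup>2)"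

lemma sup_convolution_eq:
  "sup_maximizer l u x z \<Longrightarrow> sup_convolution l u x = u z - l * (norm (x - z))\<^sup>2"
  unfolding sup_convolution_def sup_maximizer_def by (intro cSup_eq_maximum) auto

lemma sup_maximizer_exists:
  fixes u :: "real ^ 'n \<Rightarrow> real"
  assumes "continuous_on (cball 0 1) u"
  obtains z where "sup_maximizer l u x z"
proof -
  have "continuous_on (cball 0 1) (\<lambda>z. u z - l * (norm (x - z))\<^sup>2)"
    by (intro continuous_intros assms)
  from continuous_attains_sup[OF compact_cball _ this] that show thesis
    by (auto simp: sup_maximizer_def)
qed

lemma sup_convolution_ge:
  fixes u :: "real ^ 'n \<Rightarrow> real"
  assumes "continuous_on (cball 0 1) u" "w \<in> cball 0 1"
  shows "u w - l * (norm (x - w))\<^sup>2 \<le> sup_convolution l u x"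
proof -
  obtain z where z: "sup_maximizer l u x z" using sup_maximizer_exists[OF assms(1)] .
  with assms(2) show ?thesis unfolding sup_convolution_eq[OF z] by (auto simp: sup_maximizer_def)
qed

text \<open>Using the maximizer for one point as competitor at the other bounds the difference of
  values by a difference of squared distances, which gives a local Lipschitz estimate.\<close>

lemma continuous_on_sup_convolution:
  fixes u :: "real ^ 'n \<Rightarrow> real"
  assumes u: "continuous_on (cball 0 1) u" and l: "l > 0"
  shows "continuous_on S (sup_convolution l u)"
proof -
  let ?f = "sup_convolution l u"
  have diff: "?f x - ?f y \<le> l * (norm (x - y) * (norm x + norm y + 2))" for x y
  proof -
    obtain z where z: "sup_maximizer l u x z" using sup_maximizer_exists[OF u] .
    have "?f x - ?f y \<le> l * ((norm (y - z))\<^sup>2 - (norm (x - z))\<^sup>2)"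
      using sup_convolution_ge[OF u, of z l y] z
      by (auto simp: sup_convolution_eq[OF z] sup_maximizer_def algebra_simps)
    also have "(norm (y - z))\<^sup>2 - (norm (x - z))\<^sup>2 = (norm (y - z) - norm (x - z)) * (norm (y - z) + norm (x - z))"
      by (simp add: power2_eq_square algebra_simps)
    also have "\<dots> \<le> norm (x - y) * (norm x + norm y + 2)"
    proof (rule mult_mono)
      show "norm (y - z) - norm (x - z) \<le> norm (x - y)"
        using norm_triangle_ineq2[of "y - z" "x - z"] by (simp add: norm_minus_commute)
      show "norm (y - z) + norm (x - z) \<le> norm x + norm y + 2"
        using norm_triangle_ineq4[of y z] norm_triangle_ineq4[of x z] z by (auto simp: sup_maximizer_def)
    qed auto
    finally show ?thesis using l by simp
  qed
  have "isCont ?f x" for x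
  proof -
    have "((\<lambda>y. l * (norm (x - y) * (norm x + norm y + 2))) \<longlongrightarrow> l * (norm (x - x) * (norm x + norm x + 2))) (at x)"
      by (intro tendsto_intros)
    then have lim: "((\<lambda>y. l * (norm (x - y) * (norm x + norm y + 2))) \<longlongrightarrow> 0) (at x)" by simp
    have *: "\<bar>?f y - ?f x\<bar> \<le> l * (norm (x - y) * (norm x + norm y + 2))" for y
      using diff[of x y] diff[of y x]
      unfolding norm_minus_commute[of y x] add.commute[of "norm y" "norm x"] by linarith
    have "\<forall>\<^sub>F y in at x. norm (?f y - ?f x) \<le> l * (norm (x - y) * (norm x + norm y + 2))"
      using * by (intro always_eventually allI) (simp only: real_norm_def)
    from Lim_null_comparison[OF this lim] have "((\<lambda>y. ?f y - ?f x) \<longlongrightarrow> 0) (at x)" .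
    then show ?thesis by (simp add: isCont_def LIM_zero_iff)
  qed
  then show ?thesis by (simp add: continuous_at_imp_continuous_on)
qed

text \<open>A one-sided condition that \<open>u\<close> and \<open>- u\<close> share, so that every
  later comparison is proved once and applied to both.\<close>

definition polynomial_subsolution :: "real \<Rightarrow> (real ^ 'n) set \<Rightarrow> (real ^ 'n \<Rightarrow> real) \<Rightarrow> bool" where
  "polynomial_subsolution p \<Omega> u \<longleftrightarrow> (\<forall>\<phi> x. real_polynomial_function \<phi> \<longrightarrow> x \<in> \<Omega> \<longrightarrow>
     gradient \<phi> x \<noteq> 0 \<longrightarrow> local_max_at (\<lambda>y. u y - \<phi> y) x \<longrightarrow> normalized_p_laplacian p \<phi> x \<ge> 0)"

lemma viscosity_solution_subsolution:
  "viscosity_solution p \<Omega> u \<Longrightarrow> polynomial_subsolution p \<Omega> u"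
  unfolding viscosity_solution_def polynomial_subsolution_def
  by (meson UNIV_I open_UNIV polynomial_C2_on)

text \<open>The operator is odd in the test function, so a maximum of \<open>- u - \<phi>\<close> is
  a minimum of \<open>u - (- \<phi>)\<close> with the matching sign of the operator.\<close>

lemma viscosity_solution_subsolution_minus:
  fixes u :: "real ^ 'n \<Rightarrow> real"
  assumes "viscosity_solution p \<Omega> u"
  shows "polynomial_subsolution p \<Omega> (\<lambda>x. - u x)"
  unfolding polynomial_subsolution_def
proof (intro allI impI)
  fix \<phi> :: "real ^ 'n \<Rightarrow> real" and x
  assume \<phi>: "real_polynomial_function \<phi>" and x: "x \<in> \<Omega>" "gradient \<phi> x \<noteq> 0"
    and max: "local_max_at (\<lambda>y. - u y - \<phi> y) x"
  have \<psi>: "real_polynomial_function (\<lambda>x. (- 1) * \<phi> x)" by (intro polynomial_mult polynomial_const \<phi>)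
  have grad: "gradient (\<lambda>x. (- 1) * \<phi> x) x = - gradient \<phi> x"
    unfolding gradient_cmult[OF \<phi>] by simp
  have "hessian (\<lambda>x. (- 1) * \<phi> x) x + hessian \<phi> x = 0"
    unfolding hessian_add[OF \<psi> \<phi>, symmetric]
    by (simp add: vec_eq_iff polynomial_hessian polynomial_const)
  then have "hessian (\<lambda>x. (- 1) * \<phi> x) x *v v = - (hessian \<phi> x *v v)" for v
    by (metis add_eq_0_iff2 matrix_vector_mult_add_rdistrib matrix_vector_mult_0)
  then have npl: "normalized_p_laplacian p (\<lambda>x. (- 1) * \<phi> x) x = - normalized_p_laplacian p \<phi> x"
    unfolding normalized_p_laplacian_def normalized_infinity_laplacian_def laplacian_cmult[OF \<phi>] grad
    by (simp add: vec.neg algebra_simps)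
  have "local_min_at (\<lambda>y. u y - (- 1) * \<phi> y) x"
    using max unfolding local_max_at_def local_min_at_def by eventually_elim simp
  then have "normalized_p_laplacian p (\<lambda>x. (- 1) * \<phi> x) x \<le> 0"
    using assms x grad polynomial_C2_on[OF \<psi>, of UNIV] unfolding viscosity_solution_def
    by (metis UNIV_I neg_equal_0_iff_equal open_UNIV)
  then show "normalized_p_laplacian p \<phi> x \<ge> 0" unfolding npl by simp
qed

text \<open>The parabola opening downwards from \<open>z\<close> touches the sup-convolution from below, which
  determines the gradient of any test function touching from above and bounds its Hessian from below.
  Translating the test function by \<open>x - z\<close> makes it touch \<open>u\<close> at \<open>z\<close>.\<close>

lemma sup_convolution_touching:
  fixes u \<theta> :: "real ^ 'n \<Rightarrow> real"
  assumes u: "continuous_on (cball 0 1) u" and v: "polynomial_subsolution p (ball 0 1) u"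
    and z: "sup_maximizer l u x z" "z \<in> ball 0 1"
    and \<theta>: "real_polynomial_function \<theta>" and max: "local_max_at (\<lambda>y. sup_convolution l u y - \<theta> y) x"
  shows "gradient \<theta> x = (2 * l) *\<^sub>R (z - x)"
    and "(hessian \<theta> x *v w) \<bullet> w \<ge> - (2 * l * (norm w)\<^sup>2)"
    and "gradient \<theta> x \<noteq> 0 \<Longrightarrow> normalized_p_laplacian p \<theta> x \<ge> 0"
proof -
  let ?f = "sup_convolution l u"
  let ?q = "\<lambda>y. l * (norm (y - z))\<^sup>2"
  have fx: "?f x = u z - l * (norm (x - z))\<^sup>2" by (rule sup_convolution_eq[OF z(1)])
  have zc: "z \<in> cball 0 1" using z(2) by auto
  have "local_min_at (\<lambda>y. \<theta> y + ?q y) x"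
    unfolding local_min_at_def
    using max[unfolded local_max_at_def]
    by eventually_elim (use sup_convolution_ge[OF u zc, of l] fx in smt)
  note min = polynomial_add[OF \<theta> polynomial_dist_power2] this
  from gradient_zero_at_local_min[OF min] show "gradient \<theta> x = (2 * l) *\<^sub>R (z - x)"
    by (simp add: gradient_add \<theta> polynomial_dist_power2 gradient_dist_power2 algebra_simps
        add_eq_0_iff2)
  from hessian_nonneg_at_local_min[OF min, of w] show "(hessian \<theta> x *v w) \<bullet> w \<ge> - (2 * l * (norm w)\<^sup>2)"
    by (simp add: hessian_add \<theta> polynomial_dist_power2 matrix_vector_mult_add_rdistrib
        hessian_dist_power2 inner_add_left power2_norm_eq_inner[of w])
  assume g: "gradient \<theta> x \<noteq> 0"
  let ?\<phi> = "\<lambda>y. \<theta> (y + (x - z))"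
  have zx: "z + (x - z) = x" by simp
  have \<phi>: "real_polynomial_function ?\<phi>" by (rule polynomial_affine[OF \<theta> bounded_linear_ident])
  have grad: "gradient ?\<phi> z = gradient \<theta> x"
    using gradient_affine[OF \<theta> bounded_linear_ident, of "x - z" z, unfolded zx]
    by (metis vector_eq_rdot)
  have hess: "hessian ?\<phi> z *v v = hessian \<theta> x *v v" for v
    using hessian_affine[OF \<theta> bounded_linear_ident, of "x - z" z v, unfolded zx]
    by (metis vector_eq_rdot)
  have npl: "normalized_p_laplacian p ?\<phi> z = normalized_p_laplacian p \<theta> x"
    by (simp add: normalized_p_laplacian_def normalized_infinity_laplacian_def laplacian_eq_sum_forms
        grad hess)
  have "\<forall>\<^sub>F y in nhds z. ?f (y + (x - z)) - \<theta> (y + (x - z)) \<le> ?f x - \<theta> x"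
  proof -
    have "filterlim (\<lambda>y. y + (x - z)) (nhds (z + (x - z))) (nhds z)"
      by (intro tendsto_intros filterlim_ident)
    then have "filterlim (\<lambda>y. y + (x - z)) (nhds x) (nhds z)" by simp
    then show ?thesis
      using max[unfolded local_max_at_def] by (rule eventually_compose_filterlim[rotated])
  qed
  moreover have "\<forall>\<^sub>F y in nhds z. y \<in> ball 0 1"
    using z(2) by (intro eventually_nhds_in_open) auto
  ultimately have "local_max_at (\<lambda>y. u y - ?\<phi> y) z"
    unfolding local_max_at_def
  proof eventually_elim
    case (elim y)
    then have "u y - l * (norm ((y + (x - z)) - y))\<^sup>2 \<le> ?f (y + (x - z))"
      by (intro sup_convolution_ge[OF u]) auto
    with elim(1) fx show ?case by simp
  qed
  then show "normalized_p_laplacian p \<theta> x \<ge> 0"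
    using v[unfolded polynomial_subsolution_def, rule_format, OF \<phi> z(2)] g by (simp add: npl grad)
qed

text \<open>The maximizer relation is closed: along points converging to \<open>x0\<close>,
  maximizers accumulate by compactness at a maximizer for \<open>x0\<close>, and only
  \<open>z0\<close> is available.\<close>

lemma sup_maximizer_stable:
  fixes u :: "real ^ 'n \<Rightarrow> real"
  assumes u: "continuous_on (cball 0 1) u"
    and uniq: "\<And>z. sup_maximizer l u x0 z \<Longrightarrow> z = z0" and "e > 0"
  shows "\<exists>d>0. \<forall>x z. dist x x0 < d \<longrightarrow> sup_maximizer l u x z \<longrightarrow> dist z z0 < e"
proof (rule ccontr)
  assume "\<not> ?thesis"
  then have "\<forall>k. \<exists>x z. dist x x0 < 1 / real (Suc k) \<and> sup_maximizer l u x z \<and> \<not> dist z z0 < e"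
    by (metis of_nat_0_less_iff zero_less_Suc zero_less_divide_1_iff)
  then obtain X Z where XZ: "\<And>k. dist (X k) x0 < 1 / real (Suc k)" "\<And>k. sup_maximizer l u (X k) (Z k)"
    "\<And>k. \<not> dist (Z k) z0 < e" by metis
  have X: "X \<longlonglongrightarrow> x0"
    unfolding tendsto_dist_iff[of X]
  proof (rule tendsto_sandwich[OF _ _ tendsto_const LIMSEQ_inverse_real_of_nat])
    show "\<forall>\<^sub>F k in sequentially. dist (X k) x0 \<le> inverse (real (Suc k))"
      using XZ(1) by (intro always_eventually allI) (simp only: inverse_eq_divide less_imp_le)
  qed simp
  have "\<And>k. Z k \<in> cball 0 1" using XZ(2) by (auto simp: sup_maximizer_def)
  then obtain z r where zr: "z \<in> cball 0 1" "strict_mono r" "(Z \<circ> r) \<longlonglongrightarrow> z"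
    using compact_imp_seq_compact[OF compact_cball, of "0 :: real ^ 'n" 1] unfolding seq_compact_def by blast
  have Xr: "(X \<circ> r) \<longlonglongrightarrow> x0" using X zr(2) by (rule LIMSEQ_subseq_LIMSEQ)
  have uz: "(\<lambda>k. u ((Z \<circ> r) k)) \<longlonglongrightarrow> u z"
    by (rule continuous_on_tendsto_compose[OF u zr(3,1)]) (use XZ(2) in \<open>auto simp: sup_maximizer_def\<close>)
  have "sup_maximizer l u x0 z"
    unfolding sup_maximizer_def
  proof (intro conjI ballI zr(1))
    fix w :: "real ^ 'n" assume w: "w \<in> cball 0 1"
    have "(\<lambda>k. u w - l * (norm ((X \<circ> r) k - w))\<^sup>2) \<longlonglongrightarrow> u w - l * (norm (x0 - w))\<^sup>2"
      by (intro tendsto_intros Xr)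
    moreover have "(\<lambda>k. u ((Z \<circ> r) k) - l * (norm ((X \<circ> r) k - (Z \<circ> r) k))\<^sup>2) \<longlonglongrightarrow> u z - l * (norm (x0 - z))\<^sup>2"
      by (intro tendsto_intros Xr uz zr(3))
    ultimately show "u w - l * (norm (x0 - w))\<^sup>2 \<le> u z - l * (norm (x0 - z))\<^sup>2"
      by (rule LIMSEQ_le) (use XZ(2) w in \<open>auto simp: sup_maximizer_def\<close>)
  qed
  then have "z = z0" by (rule uniq)
  then obtain k where "dist ((Z \<circ> r) k) z0 < e"
    using zr(3) \<open>e > 0\<close> by (metis metric_LIMSEQ_D order_refl)
  with XZ(3) show False by simp
qed

section \<open>Freezing the coefficients\<close>

text \<open>For a unit vector \<open>e\<close> this scales by \<open>t\<close> along
  \<open>e\<close> and is the identity on the orthogonal complement; a negative \<open>t\<close>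
  includes a reflection. When \<open>t\<^sup>2 = p - 1\<close> its square is the coefficient matrix
  of the operator at gradient direction \<open>e\<close>.\<close>

definition axial_scaling :: "real \<Rightarrow> real ^ 'n \<Rightarrow> real ^ 'n \<Rightarrow> real ^ 'n" where
  "axial_scaling t e v = v + ((t - 1) * (e \<bullet> v)) *\<^sub>R e"

lemma bounded_linear_axial_scaling: "bounded_linear (axial_scaling t e)"
proof -
  have "linear (axial_scaling t e)"
    by (rule linearI) (auto simp: axial_scaling_def inner_add_right algebra_simps scaleR_add_left)
  then show ?thesis by (simp add: linear_conv_bounded_linear)
qed

lemma axial_scaling_axis [simp]: "norm e = 1 \<Longrightarrow> axial_scaling t e e = t *\<^sub>R e"
  by (simp add: axial_scaling_def dot_square_norm algebra_simps)

lemma axial_scaling_inverse: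
  assumes "norm e = 1" "s * t = 1"
  shows "axial_scaling s e (axial_scaling t e v) = v"
proof -
  have "(s - 1) * (1 + (t - 1)) + (t - 1) = 0" using assms(2) by (simp add: algebra_simps)
  have "axial_scaling s e (axial_scaling t e v) = v + (((s - 1) * (1 + (t - 1)) + (t - 1)) * (e \<bullet> v)) *\<^sub>R e"
    using assms(1) by (simp add: axial_scaling_def inner_add_right dot_square_norm algebra_simps)
  then show ?thesis using assms(2) by (simp add: algebra_simps)
qed

lemma norm_axial_scaling_power2:
  assumes "norm e = 1"
  shows "(norm (axial_scaling t e v))\<^sup>2 = (norm v)\<^sup>2 + (t\<^sup>2 - 1) * (e \<bullet> v)\<^sup>2"
proof -
  have "e \<bullet> e = 1" using assms by (simp add: norm_eq_1)
  then show ?thesis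
    unfolding axial_scaling_def power2_norm_eq_inner inner_add_left inner_add_right inner_scaleR_left
      inner_scaleR_right inner_commute[of v e]
    by (simp only:) (simp add: power2_eq_square algebra_simps)
qed

lemma norm_axial_scaling_le:
  assumes "norm e = 1"
  shows "norm (axial_scaling t e v) \<le> (1 + \<bar>t\<bar>) * norm v"
proof (rule power2_le_imp_le)
  have "(e \<bullet> v)\<^sup>2 \<le> (norm v)\<^sup>2"
    using Cauchy_Schwarz_ineq2[of e v] assms by (metis abs_le_square_iff abs_norm_cancel mult_1)
  then have "t\<^sup>2 * (e \<bullet> v)\<^sup>2 \<le> t\<^sup>2 * (norm v)\<^sup>2" by (simp add: mult_left_mono)
  then have "(norm (axial_scaling t e v))\<^sup>2 \<le> (1 + t\<^sup>2) * (norm v)\<^sup>2"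
    unfolding norm_axial_scaling_power2[OF assms] by (simp add: algebra_simps add_increasing)
  also have "\<dots> \<le> (1 + \<bar>t\<bar>)\<^sup>2 * (norm v)\<^sup>2"
    by (intro mult_right_mono) (auto simp: power2_sum)
  finally show "(norm (axial_scaling t e v))\<^sup>2 \<le> ((1 + \<bar>t\<bar>) * norm v)\<^sup>2"
    by (simp add: power_mult_distrib)
qed simp

lemma sum_axis_component: "(\<Sum>i\<in>UNIV. (e :: real ^ 'n) $ i *\<^sub>R axis i 1) = e"
  by (simp add: basis_expansion scalar_mult_eq_scaleR[symmetric])

text \<open>With \<open>T\<close> the scaling, the left side is the trace of \<open>T Z T\<close>,
  that is of \<open>Z\<close> times the square of \<open>T\<close>, which is the identity plus
  \<open>(t\<^sup>2 - 1)\<close> times \<open>tensor e e\<close>.\<close>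

lemma sum_form_axial_scaling:
  fixes Z :: "real ^ 'n ^ 'n"
  assumes "norm e = 1"
  shows "(\<Sum>i\<in>UNIV. (Z *v axial_scaling t e (axis i 1)) \<bullet> axial_scaling t e (axis i 1)) =
    trace Z + (t\<^sup>2 - 1) * ((Z *v e) \<bullet> e)"
proof -
  define c where "c = t - 1"
  let ?a = "\<lambda>i. axis i 1 :: real ^ 'n"
  have T: "axial_scaling t e (?a i) = ?a i + (c * e $ i) *\<^sub>R e" for i
    by (simp add: axial_scaling_def c_def inner_axis)
  have "(Z *v axial_scaling t e (?a i)) \<bullet> axial_scaling t e (?a i) =
      Z $ i $ i + c * (e $ i * ((Z *v ?a i) \<bullet> e)) + c * (e $ i * ((Z *v e) $ i)) + c\<^sup>2 * ((e $ i)\<^sup>2 * ((Z *v e) \<bullet> e))" for i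
    by (simp add: T matrix_vector_right_distrib matrix_vector_mult_scaleR inner_add_left inner_add_right
        inner_axis matrix_vector_mul_component[of Z "?a i" i] power2_eq_square algebra_simps)
  moreover have "(\<Sum>i\<in>UNIV. e $ i * ((Z *v ?a i) \<bullet> e)) = (Z *v e) \<bullet> e"
  proof -
    have "(Z *v (\<Sum>i\<in>UNIV. e $ i *\<^sub>R ?a i)) \<bullet> e = (\<Sum>i\<in>UNIV. e $ i * ((Z *v ?a i) \<bullet> e))"
      by (simp add: linear_sum[OF matrix_vector_mul_linear] matrix_vector_mult_scaleR inner_sum_left)
    then show ?thesis by (simp add: sum_axis_component)
  qed
  moreover have "(\<Sum>i\<in>UNIV. e $ i * ((Z *v e) $ i)) = (Z *v e) \<bullet> e"
    by (simp add: inner_vec_def mult.commute)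
  moreover have "(\<Sum>i\<in>UNIV. (e $ i)\<^sup>2 * ((Z *v e) \<bullet> e)) = (Z *v e) \<bullet> e"
  proof -
    have "(\<Sum>i\<in>UNIV. (e $ i)\<^sup>2) = 1"
      using assms by (simp add: norm_eq_1 inner_vec_def power2_eq_square)
    then show ?thesis by (simp add: sum_distrib_right[symmetric])
  qed
  ultimately have "(\<Sum>i\<in>UNIV. (Z *v axial_scaling t e (?a i)) \<bullet> axial_scaling t e (?a i)) =
      trace Z + c * ((Z *v e) \<bullet> e) + c * ((Z *v e) \<bullet> e) + c\<^sup>2 * ((Z *v e) \<bullet> e)"
    by (simp add: sum.distrib sum_distrib_left[symmetric] trace_def)
  then show ?thesis by (simp add: c_def power2_eq_square algebra_simps)
qed

text \<open>\<open>Z + \<mu> I\<close> is nonnegative with trace at most \<open>n \<mu>\<close>, which bounds all symmetrized entries of \<open>Z\<close>.\<close>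

lemma form_difference_bound:
  fixes Z :: "real ^ 'n ^ 'n"
  assumes lower: "\<And>v. (Z *v v) \<bullet> v \<ge> - (\<mu> * (norm v)\<^sup>2)" and tr: "trace Z \<le> 0" and "\<mu> \<ge> 0"
  defines "n \<equiv> real CARD('n)"
  shows "\<bar>(Z *v a) \<bullet> a - (Z *v b) \<bullet> b\<bar> \<le> n\<^sup>2 * ((n + 1) * \<mu>) * (norm (a - b) * (norm a + norm b))"
proof -
  let ?a = "\<lambda>i. axis i 1 :: real ^ 'n"
  have entry: "(Z *v ?a j) \<bullet> ?a i = Z $ i $ j" for i j
    by (simp add: inner_axis matrix_vector_mult_basis column_def)
  have diag: "Z $ i $ i + \<mu> \<ge> 0" for i
    using lower[of "?a i"] by (simp add: entry)
  have diag_le: "Z $ i $ i + \<mu> \<le> n * \<mu>" for i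
  proof -
    have "Z $ i $ i + \<mu> \<le> (\<Sum>i\<in>UNIV. Z $ i $ i + \<mu>)"
      by (rule member_le_sum) (use diag in auto)
    also have "\<dots> \<le> n * \<mu>" using tr by (simp add: sum.distrib trace_def n_def)
    finally show ?thesis .
  qed
  have sym: "\<bar>Z $ i $ j + Z $ j $ i\<bar> / 2 \<le> (n + 1) * \<mu>" for i j
  proof -
    \<comment> \<open>\<open>d\<close> is 1 or 0 according to whether \<open>i = j\<close>, so
      polarization with the sum and difference of two axes treats diagonal and off-diagonal entries
      together.\<close>
    define d where "d = ?a i \<bullet> ?a j"
    have d: "\<bar>d\<bar> \<le> 1" unfolding d_def by (simp add: inner_axis_axis)
    have np: "(norm (?a i + ?a j))\<^sup>2 = 2 + 2 * d" and nm: "(norm (?a i - ?a j))\<^sup>2 = 2 - 2 * d"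
      unfolding power2_norm_eq_inner inner_add_left inner_add_right inner_diff_left inner_diff_right
      by (auto simp: d_def inner_axis_axis)
    have "Z $ i $ i + Z $ j $ j + (Z $ i $ j + Z $ j $ i) \<ge> - (\<mu> * (2 + 2 * d))"
      using lower[of "?a i + ?a j"]
      unfolding np matrix_vector_right_distrib inner_add_left inner_add_right entry by linarith
    moreover have "Z $ i $ i + Z $ j $ j - (Z $ i $ j + Z $ j $ i) \<ge> - (\<mu> * (2 - 2 * d))"
      using lower[of "?a i - ?a j"]
      unfolding nm matrix_vector_mult_diff_distrib inner_diff_left inner_diff_right entry by linarith
    moreover have "\<bar>\<mu> * (2 * d)\<bar> \<le> 2 * \<mu>" using d \<open>\<mu> \<ge> 0\<close>
      by (simp add: abs_mult mult_left_le)
    ultimately show ?thesis using diag_le[of i] diag_le[of j] by (simp add: algebra_simps abs_le_iff)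
  qed
  have form: "(Z *v x) \<bullet> x = (\<Sum>i\<in>UNIV. \<Sum>j\<in>UNIV. (x $ i * x $ j) * ((Z $ i $ j + Z $ j $ i) / 2))" for x
  proof -
    have "(Z *v x) \<bullet> x = (\<Sum>i\<in>UNIV. \<Sum>j\<in>UNIV. (x $ i * x $ j) * Z $ i $ j)"
      by (simp add: inner_vec_def matrix_vector_mult_def sum_distrib_left sum_distrib_right mult_ac)
    moreover have "\<dots> = (\<Sum>i\<in>UNIV. \<Sum>j\<in>UNIV. (x $ i * x $ j) * Z $ j $ i)"
      by (subst sum.swap) (simp add: mult_ac)
    ultimately show ?thesis
      by (simp add: add_divide_distrib distrib_left sum.distrib sum_divide_distrib[symmetric])
  qed
  have "\<bar>(Z *v a) \<bullet> a - (Z *v b) \<bullet> b\<bar> =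
      \<bar>\<Sum>i\<in>UNIV. \<Sum>j\<in>UNIV. (a $ i * a $ j - b $ i * b $ j) * ((Z $ i $ j + Z $ j $ i) / 2)\<bar>"
    unfolding form sum_subtractf[symmetric] by (simp only: left_diff_distrib)
  also have "\<dots> \<le> (\<Sum>i\<in>(UNIV :: 'n set). \<Sum>j\<in>(UNIV :: 'n set). (norm (a - b) * (norm a + norm b)) * ((n + 1) * \<mu>))"
  proof (intro order_trans[OF sum_abs] sum_mono)
    fix i j
    have "a $ i * a $ j - b $ i * b $ j = (a - b) $ i * a $ j + b $ i * (a - b) $ j"
      by (simp add: algebra_simps)
    also have "\<bar>\<dots>\<bar> \<le> norm (a - b) * norm a + norm b * norm (a - b)"
      by (intro order_trans[OF abs_triangle_ineq] add_mono; unfold abs_mult; intro mult_mono component_le_norm_cart) auto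
    finally have "\<bar>a $ i * a $ j - b $ i * b $ j\<bar> \<le> norm (a - b) * (norm a + norm b)"
      by (simp add: algebra_simps)
    moreover have "\<bar>(Z $ i $ j + Z $ j $ i) / 2\<bar> \<le> (n + 1) * \<mu>" using sym[of i j] by simp
    ultimately show "\<bar>(a $ i * a $ j - b $ i * b $ j) * ((Z $ i $ j + Z $ j $ i) / 2)\<bar> \<le>
        (norm (a - b) * (norm a + norm b)) * ((n + 1) * \<mu>)"
      unfolding abs_mult[of "a $ i * a $ j - b $ i * b $ j"] by (intro mult_mono) auto
  qed
  also have "\<dots> = n\<^sup>2 * ((n + 1) * \<mu>) * (norm (a - b) * (norm a + norm b))"
    by (simp add: n_def power2_eq_square)
  finally show ?thesis .
qed

text \<open>The operator with coefficients frozen at \<open>x0\<close> becomes the Laplacian after the linear change of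
  variables \<open>axial_scaling t e\<close>, for either square root \<open>t\<close> of \<open>p - 1\<close>. Uniqueness of the maximizer
  at \<open>x0\<close> forces gradients of test functions touching near \<open>x0\<close> to point almost along \<open>e\<close>, and the
  resulting error is beaten by \<open>\<tau>\<close> because Hessians of such test functions are bounded.\<close>

lemma frozen_comparison:
  fixes u :: "real ^ 'n \<Rightarrow> real" and x0 z0 :: "real ^ 'n"
  assumes u: "continuous_on (cball 0 1) u" and visc: "polynomial_subsolution p (ball 0 1) u"
    and l: "l > 0" and p: "p > 1" and t: "t\<^sup>2 = p - 1" and \<tau>: "\<tau> > 0"
    and uniq: "\<And>z. sup_maximizer l u x0 z \<Longrightarrow> z = z0" and z0: "z0 \<in> ball 0 1" "z0 \<noteq> x0"
  defines "e \<equiv> sgn (z0 - x0)"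
  shows "\<exists>\<rho>>0. \<forall>r h. 0 < r \<longrightarrow> r < \<rho> \<longrightarrow> real_polynomial_function h \<longrightarrow> (\<forall>z. laplacian h z = 0) \<longrightarrow>
    (\<forall>z. norm z = r \<longrightarrow> sup_convolution l u (x0 + axial_scaling t e z) \<le> h z) \<longrightarrow>
    sup_convolution l u x0 \<le> h 0 + \<tau> * r\<^sup>2"
proof -
  define n where "n = real CARD('n)"
  \<comment> \<open>\<open>\<mu>\<close> is the lower Hessian bound \<open>2 * l\<close> of the
    convolution carried through the scaling, \<open>C\<close> bounds the inverse scaling, and
    \<open>B\<close> bounds the change of the quadratic form per unit of error in the gradient
    direction.\<close>
  define \<mu> where "\<mu> = 2 * l * (1 + \<bar>t\<bar>)\<^sup>2"
  define C where "C = 1 + \<bar>1 / t\<bar>"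
  define B where "B = n\<^sup>2 * ((n + 1) * \<mu>) * (2 * C\<^sup>2)"
  let ?T = "axial_scaling t e" and ?S = "axial_scaling (1 / t) e"
  let ?f = "sup_convolution l u"
  have n: "n > 0" by (simp add: n_def)
  have e: "norm e = 1" using z0 by (simp add: e_def norm_sgn)
  have t0: "t \<noteq> 0" using t p by auto
  have ST: "?S (?T v) = v" and TS: "?T (?S v) = v" for v
    using axial_scaling_inverse[OF e] t0 by auto
  have \<mu>: "\<mu> \<ge> 0" using l by (simp add: \<mu>_def)
  have C: "C \<ge> 1" by (simp add: C_def)
  have B: "B \<ge> 0" using \<mu> n C by (simp add: B_def)
  \<comment> \<open>The admissible direction error: it keeps
    \<open>\<bar>p - 2\<bar> * (B * \<kappa>)\<close> below \<open>2 * n * \<tau>\<close>, the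
    amount by which the barrier is superharmonic. The cap at 1 rules out a maximizer equal to its
    base point, as \<open>sgn 0 = 0\<close> is at distance 1 from \<open>e\<close>.\<close>
  define \<kappa> where "\<kappa> = min 1 (n * \<tau> / (\<bar>p - 2\<bar> * B + 1))"
  have \<kappa>: "\<kappa> > 0" using n \<tau> B by (simp add: \<kappa>_def add_nonneg_pos)
  have \<kappa>B: "\<bar>p - 2\<bar> * (B * \<kappa>) < 2 * n * \<tau>"
  proof -
    have pos: "0 < \<bar>p - 2\<bar> * B + 1" using B by (simp add: add_nonneg_pos)
    have "\<bar>p - 2\<bar> * B * \<kappa> \<le> \<bar>p - 2\<bar> * B * (n * \<tau> / (\<bar>p - 2\<bar> * B + 1))"
      by (intro mult_left_mono) (use B in \<open>auto simp: \<kappa>_def\<close>)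
    also have "\<dots> \<le> n * \<tau>" using pos n \<tau> by (simp add: field_simps)
    also have "\<dots> < 2 * n * \<tau>" using n \<tau> by simp
    finally show ?thesis by (simp add: mult.assoc)
  qed
  obtain \<rho>1 where \<rho>1: "\<rho>1 > 0"
    "\<And>x z. dist x x0 < \<rho>1 \<Longrightarrow> sup_maximizer l u x z \<Longrightarrow> z \<in> ball 0 1 \<and> norm (sgn (z - x) - e) < \<kappa>"
  proof -
    have "isCont (\<lambda>w. sgn (snd w - fst w)) (x0, z0)"
      using z0(2) by (intro continuous_intros) auto
    then obtain d where d: "d > 0" "\<And>w. dist w (x0, z0) < d \<Longrightarrow> dist (sgn (snd w - fst w)) e < \<kappa>"
      using \<kappa> unfolding continuous_at_eps_delta e_def by (metis fst_conv snd_conv)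
    define d' where "d' = min (d / 2) (1 - norm z0)"
    have "d' > 0" using d(1) z0(1) by (simp add: d'_def)
    from sup_maximizer_stable[OF u uniq this] obtain d1 where d1: "d1 > 0"
      "\<And>x z. dist x x0 < d1 \<Longrightarrow> sup_maximizer l u x z \<Longrightarrow> dist z z0 < d'" by blast
    show thesis
    proof (rule that[of "min d1 (d / 2)"])
      show "min d1 (d / 2) > 0" using d1 d by simp
      fix x z assume xz: "dist x x0 < min d1 (d / 2)" "sup_maximizer l u x z"
      then have z: "dist z z0 < d'" using d1(2)[of x z] by simp
      have "norm z \<le> norm (z - z0) + norm z0" using norm_triangle_ineq[of "z - z0" z0] by simp
      then have "z \<in> ball 0 1" using z by (simp add: d'_def dist_norm)
      moreover have "dist (x, z) (x0, z0) < d"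
        using dist_Pair_Pair[of x z x0 z0] sqrt_sum_squares_le_sum[of "dist x x0" "dist z z0"] xz(1) z
        by (simp add: d'_def)
      ultimately show "z \<in> ball 0 1 \<and> norm (sgn (z - x) - e) < \<kappa>"
        using d(2)[of "(x, z)"] by (simp add: dist_norm)
    qed
  qed
  show ?thesis
  proof (intro exI[of _ "\<rho>1 / (1 + \<bar>t\<bar>)"] conjI allI impI)
    show "0 < \<rho>1 / (1 + \<bar>t\<bar>)" using \<rho>1(1) by (simp add: add_pos_nonneg)
  next
    fix r :: real and h :: "real ^ 'n \<Rightarrow> real"
    assume r: "0 < r" "r < \<rho>1 / (1 + \<bar>t\<bar>)" and h: "real_polynomial_function h" "\<forall>z. laplacian h z = 0"
      and bd: "\<forall>z. norm z = r \<longrightarrow> ?f (x0 + ?T z) \<le> h z"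
    show "?f x0 \<le> h 0 + \<tau> * r\<^sup>2"
    proof (rule ccontr)
      assume neg: "\<not> ?f x0 \<le> h 0 + \<tau> * r\<^sup>2"
      \<comment> \<open>Adding \<open>\<tau> * (r\<^sup>2 - |z|\<^sup>2)\<close> keeps the boundary
        values of \<open>h\<close>, makes it strictly superharmonic, and gives exactly the value at
        0 that the negated claim puts below the convolution. Hence the difference has an interior
        maximum.\<close>
      define \<eta> where "\<eta> = (\<lambda>z. (h z + (- \<tau>) * (norm (z - 0))\<^sup>2) + \<tau> * r\<^sup>2)"
      have \<eta>0: "real_polynomial_function (\<lambda>z. h z + (- \<tau>) * (norm (z - 0))\<^sup>2)"
        by (rule polynomial_add[OF h(1) polynomial_dist_power2])
      have \<eta>: "real_polynomial_function \<eta>"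
        unfolding \<eta>_def by (rule polynomial_add[OF \<eta>0 polynomial_const])
      have lap\<eta>: "laplacian \<eta> z = - (2 * n * \<tau>)" for z
        unfolding \<eta>_def laplacian_add[OF \<eta>0 polynomial_const]
          laplacian_add[OF h(1) polynomial_dist_power2]
        using h(2) laplacian_cmult[OF polynomial_norm_power2, of "- \<tau>" z]
        by (simp add: laplacian_norm_power2 n_def)
      define D where "D = (\<lambda>z. ?f (x0 + ?T z) - \<eta> z)"
      have "continuous_on (cball 0 r) (\<lambda>z. ?f (x0 + ?T z))"
        by (intro continuous_on_compose2[OF continuous_on_sup_convolution[OF u l, of UNIV]]
            continuous_intros linear_continuous_on bounded_linear_axial_scaling) auto
      then have "continuous_on (cball 0 r) D"
        unfolding D_def by (intro continuous_intros polynomial_continuous_on[OF \<eta>])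
      from continuous_attains_sup[OF compact_cball _ this] r(1)
      obtain m where m: "m \<in> cball 0 r" "\<And>y. y \<in> cball 0 r \<Longrightarrow> D y \<le> D m" by auto
      have "?T 0 = 0" by (simp add: axial_scaling_def)
      then have "D 0 > 0" using neg by (simp add: D_def \<eta>_def)
      then have "D m > 0" using m(2)[of 0] r(1) by simp
      moreover have "D m \<le> 0" if "norm m = r" using bd that by (simp add: D_def \<eta>_def)
      ultimately have m_int: "norm m < r" using m(1) by fastforce
      define x1 where "x1 = x0 + ?T m"
      define \<theta> where "\<theta> = (\<lambda>x. \<eta> (?S x + (- ?S x0)))"
      have Sdiff: "?S x + (- ?S x0) = ?S (x - x0)" for x
        by (simp add: linear_diff bounded_linear.linear[OF bounded_linear_axial_scaling])
      have \<theta>: "real_polynomial_function \<theta>"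
        unfolding \<theta>_def by (rule polynomial_affine[OF \<eta> bounded_linear_axial_scaling])
      have Sx1: "?S x1 + (- ?S x0) = m" unfolding Sdiff by (simp add: x1_def ST)
      have "\<forall>\<^sub>F x in nhds x1. ?S x + (- ?S x0) \<in> ball 0 r"
      proof -
        have "isCont (\<lambda>x. ?S x + (- ?S x0)) x1"
          by (intro continuous_intros linear_continuous_at bounded_linear_axial_scaling)
        then have "filterlim (\<lambda>x. ?S x + (- ?S x0)) (nhds (?S x1 + (- ?S x0))) (nhds x1)"
          unfolding isCont_def by (rule tendsto_at_iff_tendsto_nhds[THEN iffD1])
        then have "filterlim (\<lambda>x. ?S x + (- ?S x0)) (nhds m) (nhds x1)"
          unfolding Sx1 .
        moreover have "\<forall>\<^sub>F z in nhds m. z \<in> ball 0 r"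
          using m_int by (intro eventually_nhds_in_open) auto
        ultimately show ?thesis by (rule eventually_compose_filterlim[rotated])
      qed
      then have max: "local_max_at (\<lambda>x. ?f x - \<theta> x) x1"
        unfolding local_max_at_def
      proof eventually_elim
        case (elim x)
        have "?f x - \<theta> x = D (?S x + (- ?S x0))" unfolding D_def \<theta>_def Sdiff TS by simp
        also have "\<dots> \<le> D m" using elim by (intro m(2)) auto
        also have "\<dots> = ?f x1 - \<theta> x1" unfolding D_def \<theta>_def Sx1 by (simp add: x1_def)
        finally show ?case .
      qed
      have "dist x1 x0 < \<rho>1"
      proof -
        have "dist x1 x0 \<le> (1 + \<bar>t\<bar>) * norm m"
          using norm_axial_scaling_le[OF e] by (simp add: x1_def dist_norm)
        also have "\<dots> \<le> (1 + \<bar>t\<bar>) * r" using m_int by (intro mult_left_mono) auto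
        also have "\<dots> < \<rho>1" using r(2) by (simp add: pos_less_divide_eq add_pos_nonneg mult.commute)
        finally show ?thesis .
      qed
      moreover obtain z1 where z1: "sup_maximizer l u x1 z1" using sup_maximizer_exists[OF u] .
      ultimately have z1': "z1 \<in> ball 0 1" "norm (sgn (z1 - x1) - e) < \<kappa>" using \<rho>1(2) by auto
      note touch = sup_convolution_touching[OF u visc z1 z1'(1) \<theta> max]
      define Z where "Z = hessian \<eta> m"
      define \<nu> where "\<nu> = sgn (z1 - x1)"
      have z1x1: "z1 \<noteq> x1" using z1'(2) e by (auto simp: \<kappa>_def)
      have \<nu>: "norm \<nu> = 1" using z1x1 by (simp add: \<nu>_def norm_sgn)
      have hess: "(hessian \<theta> x1 *v v) \<bullet> w = (Z *v ?S v) \<bullet> ?S w" for v w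
        unfolding \<theta>_def hessian_affine[OF \<eta> bounded_linear_axial_scaling] Sx1 Z_def by (rule refl)
      have lower: "(Z *v v) \<bullet> v \<ge> - (\<mu> * (norm v)\<^sup>2)" for v
      proof -
        have "(norm (?T v))\<^sup>2 \<le> ((1 + \<bar>t\<bar>) * norm v)\<^sup>2"
          by (intro power_mono norm_axial_scaling_le e) auto
        then have "2 * l * (norm (?T v))\<^sup>2 \<le> \<mu> * (norm v)\<^sup>2"
          using l by (simp add: \<mu>_def power_mult_distrib mult.assoc)
        then show ?thesis using touch(2)[of "?T v"] by (simp add: hess ST)
      qed
      have trZ: "trace Z = - (2 * n * \<tau>)" using lap\<eta>[of m] by (simp add: laplacian_def Z_def)
      have bound: "\<bar>(Z *v ?S \<nu>) \<bullet> ?S \<nu> - (Z *v ?S e) \<bullet> ?S e\<bar> \<le> B * \<kappa>"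
      proof -
        have "\<bar>(Z *v ?S \<nu>) \<bullet> ?S \<nu> - (Z *v ?S e) \<bullet> ?S e\<bar> \<le>
            n\<^sup>2 * ((n + 1) * \<mu>) * (norm (?S \<nu> - ?S e) * (norm (?S \<nu>) + norm (?S e)))"
          unfolding n_def by (rule form_difference_bound[OF lower _ \<mu>]) (use trZ n \<tau> in simp)
        also have "\<dots> \<le> n\<^sup>2 * ((n + 1) * \<mu>) * ((C * \<kappa>) * (C + C))"
        proof (intro mult_left_mono mult_mono add_mono)
          have "norm (?S \<nu> - ?S e) \<le> C * norm (\<nu> - e)"
            using norm_axial_scaling_le[OF e, of "1 / t" "\<nu> - e"]
            by (simp add: C_def linear_diff bounded_linear.linear[OF bounded_linear_axial_scaling])
          also have "\<dots> \<le> C * \<kappa>" using z1'(2) C by (intro mult_left_mono) (auto simp: \<nu>_def)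
          finally show "norm (?S \<nu> - ?S e) \<le> C * \<kappa>" .
          show "norm (?S \<nu>) \<le> C" "norm (?S e) \<le> C"
            using norm_axial_scaling_le[OF e, of "1 / t" \<nu>] norm_axial_scaling_le[OF e, of "1 / t" e] e \<nu>
            by (auto simp only: C_def mult_1_right)
        qed (use C \<kappa> n \<mu> in auto)
        also have "\<dots> = B * \<kappa>" by (simp add: B_def power2_eq_square algebra_simps)
        finally show ?thesis .
      qed
      have grad: "gradient \<theta> x1 = (2 * l) *\<^sub>R (z1 - x1)" by (rule touch(1))
      then have "gradient \<theta> x1 \<noteq> 0" using l z1x1 by simp
      from touch(3)[OF this] have "laplacian \<theta> x1 +
          (p - 2) * (inverse ((norm (gradient \<theta> x1))\<^sup>2) * ((hessian \<theta> x1 *v gradient \<theta> x1) \<bullet> gradient \<theta> x1)) \<ge> 0"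
        unfolding normalized_p_laplacian_def normalized_infinity_laplacian_def .
      moreover have "inverse ((norm (gradient \<theta> x1))\<^sup>2) * ((hessian \<theta> x1 *v gradient \<theta> x1) \<bullet> gradient \<theta> x1)
          = (hessian \<theta> x1 *v \<nu>) \<bullet> \<nu>"
      proof -
        define g where "g = gradient \<theta> x1"
        have "\<nu> = inverse (norm g) *\<^sub>R g"
          using l by (simp add: g_def grad \<nu>_def sgn_div_norm)
        then show ?thesis unfolding g_def[symmetric]
          by (simp add: matrix_vector_mult_scaleR power2_eq_square)
      qed
      moreover have "laplacian \<theta> x1 = trace Z + ((1 / t)\<^sup>2 - 1) * ((Z *v e) \<bullet> e)"
        unfolding laplacian_eq_sum_forms hess by (rule sum_form_axial_scaling[OF e])
      moreover have "(Z *v ?S e) \<bullet> ?S e = (1 / t)\<^sup>2 * ((Z *v e) \<bullet> e)"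
        using e by (simp add: matrix_vector_mult_scaleR power2_eq_square)
      \<comment> \<open>Here \<open>t\<^sup>2 = p - 1\<close> enters: in the scaled variables all
        terms along \<open>e\<close> cancel, leaving the trace of \<open>Z\<close> and the error
        from replacing \<open>e\<close> by \<open>\<nu>\<close>.\<close>
      moreover have "(p - 2) * ((1 / t)\<^sup>2 * ((Z *v e) \<bullet> e)) + ((1 / t)\<^sup>2 - 1) * ((Z *v e) \<bullet> e) = 0"
      proof -
        have "p - 2 = t\<^sup>2 - 1" using t by simp
        then show ?thesis using t0 by (simp add: field_simps power2_eq_square)
      qed
      ultimately have "0 \<le> trace Z + (p - 2) * ((Z *v ?S \<nu>) \<bullet> ?S \<nu> - (Z *v ?S e) \<bullet> ?S e)"
        unfolding hess by (simp add: algebra_simps)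
      also have "\<dots> \<le> trace Z + \<bar>p - 2\<bar> * (B * \<kappa>)"
        using mult_left_mono[OF bound, of "\<bar>p - 2\<bar>"] abs_ge_self
        by (simp add: abs_mult[symmetric])
      also have "\<dots> < 0" using trZ \<kappa>B by simp
      finally show False by simp
    qed
  qed
qed

section \<open>Doubling of variables\<close>

text \<open>The difference of the two sides vanishes to first order at 0 and has second derivative
  \<open>a * (1 - a - 2 * b)\<close> there, positive because \<open>b\<close> is below the size
  \<open>(1 - a) / 2\<close> of the Taylor coefficient. So its derivative has the sign of
  \<open>v\<close> near 0.\<close>

lemma powr_second_order_bound:
  fixes a b :: real
  assumes "0 < a" "a < 1" and b: "2 * b < 1 - a"
  shows "\<exists>\<eta>>0. \<forall>v. \<bar>v\<bar> < \<eta> \<longrightarrow> (1 + v) powr a \<le> 1 + a * v - a * b * v\<^sup>2"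
proof -
  define \<phi> where "\<phi> = (\<lambda>v. 1 + a * v - a * b * v\<^sup>2 - (1 + v) powr a)"
  define \<psi> where "\<psi> = (\<lambda>v. a - 2 * a * b * v - a * (1 + v) powr (a - 1))"
  have pw: "((\<lambda>v. (1 + v) powr c) has_real_derivative c * (1 + v) powr (c - 1)) (at v)"
    if "v > -1" for v c :: real
  proof -
    have "((\<lambda>v. 1 + v) has_real_derivative 1) (at v)" by (auto intro!: derivative_eq_intros)
    from DERIV_fun_powr[OF this, of c] show ?thesis using that by simp
  qed
  have \<phi>: "(\<phi> has_real_derivative \<psi> v) (at v)" if "v > -1" for v
  proof -
    have "((\<lambda>v. 1 + a * v - a * b * v\<^sup>2) has_real_derivative a - 2 * a * b * v) (at v)"
      by (auto intro!: derivative_eq_intros)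
    from DERIV_diff[OF this pw[OF that]] show ?thesis unfolding \<phi>_def \<psi>_def .
  qed
  have "(\<psi> has_real_derivative (- (2 * a * b) - a * ((a - 1) * (1 + 0) powr (a - 1 - 1)))) (at 0)"
  proof -
    have "((\<lambda>v. a - 2 * a * b * v) has_real_derivative - (2 * a * b)) (at 0)"
      by (auto intro!: derivative_eq_intros)
    from DERIV_diff[OF this DERIV_cmult[OF pw[of 0 "a - 1"], of a]] show ?thesis
      unfolding \<psi>_def by simp
  qed
  then have "(\<psi> has_real_derivative (a * (1 - a - 2 * b))) (at 0)" by (simp add: algebra_simps)
  moreover have "a * (1 - a - 2 * b) > 0" using assms by simp
  ultimately obtain d1 d2 where d: "d1 > 0" "\<And>h. 0 < h \<Longrightarrow> h < d1 \<Longrightarrow> \<psi> 0 < \<psi> (0 + h)"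
    "d2 > 0" "\<And>h. 0 < h \<Longrightarrow> h < d2 \<Longrightarrow> \<psi> (0 - h) < \<psi> 0"
    using DERIV_pos_inc_right[of \<psi> "a * (1 - a - 2 * b)" 0]
      DERIV_pos_inc_left[of \<psi> "a * (1 - a - 2 * b)" 0] by auto
  have \<psi>0: "\<psi> 0 = 0" "\<phi> 0 = 0" by (auto simp: \<psi>_def \<phi>_def)
  define \<eta> where "\<eta> = min (min d1 d2) 1"
  have "\<phi> v \<ge> 0" if v: "\<bar>v\<bar> < \<eta>" for v
  proof -
    consider "v = 0" | "v > 0" | "v < 0" by linarith
    then show ?thesis
    proof cases
      case 2
      obtain z where "0 < z" "z < v" "\<phi> v - \<phi> 0 = (v - 0) * \<psi> z"
        using MVT2[OF 2, of \<phi> \<psi>] \<phi> by auto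
      moreover have "\<psi> z > 0" using d(2)[of z] \<psi>0 calculation v by (auto simp: \<eta>_def)
      ultimately show ?thesis using 2 \<psi>0 by simp
    next
      case 3
      have "\<And>x. v \<le> x \<Longrightarrow> x \<le> 0 \<Longrightarrow> (\<phi> has_real_derivative \<psi> x) (at x)"
        using v by (intro \<phi>) (auto simp: \<eta>_def)
      then obtain z where z: "v < z" "z < 0" "\<phi> 0 - \<phi> v = (0 - v) * \<psi> z"
        using MVT2[OF 3, of \<phi> \<psi>] by auto
      moreover have "\<psi> z < 0" using d(4)[of "- z"] \<psi>0 z v by (auto simp: \<eta>_def)
      ultimately have "(0 - v) * \<psi> z < 0" using 3 by (intro mult_pos_neg) auto
      then show ?thesis using z \<psi>0 by simp
    qed (use \<psi>0 in simp)
  qed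
  moreover have "\<eta> > 0" using d by (simp add: \<eta>_def)
  ultimately show ?thesis by (intro exI[of _ \<eta>]) (auto simp: \<phi>_def)
qed

section \<open>Traces and norms for a pair of axial scalings\<close>

lemma laplacian_norm_affine:
  fixes S :: "real ^ 'n \<Rightarrow> real ^ 'n"
  assumes "bounded_linear S"
  shows "laplacian (\<lambda>z. (norm (S z + c))\<^sup>2) z = 2 * (\<Sum>i\<in>UNIV. (norm (S (axis i 1)))\<^sup>2)"
proof -
  have "(hessian (\<lambda>z :: real ^ 'n. (norm z)\<^sup>2) x *v v) = 2 *\<^sub>R v" for x v
    using hessian_dist_power2[of 1 0 x v] by simp
  then show ?thesis
    unfolding laplacian_eq_sum_forms hessian_affine[OF polynomial_norm_power2 assms]
    by (simp add: dot_square_norm sum_distrib_left)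
qed

lemma gradient_norm_affine:
  fixes S :: "real ^ 'n \<Rightarrow> real ^ 'n"
  assumes "bounded_linear S"
  shows "gradient (\<lambda>z. (norm (S z + c))\<^sup>2) z \<bullet> v = 2 * ((S z + c) \<bullet> S v)"
  by (simp add: gradient_affine[OF polynomial_norm_power2 assms] gradient_norm_power2)

text \<open>Only the line spanned by \<open>e\<close> matters; the gradient on the \<open>y\<close>
  side points along \<open>- w\<close>, yet the same scaling serves.\<close>

lemma axial_scaling_minus: "axial_scaling t (- e) = axial_scaling t e"
  by (simp add: axial_scaling_def fun_eq_iff)

lemma sum_norm_axial_scaling:
  fixes e :: "real ^ 'n"
  assumes "norm e = 1"
  shows "(\<Sum>i\<in>UNIV. (norm (axial_scaling t e (axis i 1)))\<^sup>2) = real CARD('n) + (t\<^sup>2 - 1)"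
proof -
  have "(\<Sum>i\<in>UNIV. (e $ i)\<^sup>2) = 1"
    using assms by (simp add: norm_eq_1 inner_vec_def power2_eq_square)
  then show ?thesis
    by (simp add: norm_axial_scaling_power2[OF assms] inner_axis sum.distrib sum_distrib_left[symmetric])
qed

text \<open>The difference is the operator \<open>(s - 1)\<close> times \<open>tensor e' e'\<close>
  plus \<open>(s + 1)\<close> times \<open>tensor e e\<close>, and the sum is its squared
  Hilbert-Schmidt norm. It equals \<open>4 * s\<^sup>2\<close> when the axes span the same
  line.\<close>

lemma sum_norm_axial_scaling_diff:
  fixes e e' :: "real ^ 'n"
  assumes "norm e = 1" "norm e' = 1"
  shows "(\<Sum>i\<in>UNIV. (norm (axial_scaling s e' (axis i 1) - axial_scaling (- s) e (axis i 1)))\<^sup>2) =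
    (s - 1)\<^sup>2 + (s + 1)\<^sup>2 + 2 * (s\<^sup>2 - 1) * (e \<bullet> e')\<^sup>2"
proof -
  have n: "(\<Sum>i\<in>UNIV. (e $ i)\<^sup>2) = 1" "(\<Sum>i\<in>UNIV. (e' $ i)\<^sup>2) = 1" "(\<Sum>i\<in>UNIV. e $ i * e' $ i) = e \<bullet> e'"
    using assms by (simp_all add: norm_eq_1 inner_vec_def power2_eq_square)
  have e: "e \<bullet> e = 1" "e' \<bullet> e' = 1" using assms by (simp_all add: norm_eq_1)
  have "(norm (axial_scaling s e' (axis i 1) - axial_scaling (- s) e (axis i 1)))\<^sup>2 =
      (s - 1)\<^sup>2 * (e' $ i)\<^sup>2 + (s + 1)\<^sup>2 * (e $ i)\<^sup>2 + (2 * (s\<^sup>2 - 1) * (e \<bullet> e')) * (e $ i * e' $ i)" for i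
  proof -
    have "axial_scaling s e' (axis i 1) - axial_scaling (- s) e (axis i 1) =
        ((s - 1) * e' $ i) *\<^sub>R e' + ((s + 1) * e $ i) *\<^sub>R e"
      by (simp add: axial_scaling_def inner_axis algebra_simps)
    then show ?thesis
      unfolding power2_norm_eq_inner inner_add_left inner_add_right inner_scaleR_left inner_scaleR_right
        inner_commute[of e' e] e
      by (simp only:) (simp add: inner_add_left inner_add_right e inner_commute[of e' e] power2_eq_square algebra_simps)
  qed
  then show ?thesis
    by (simp only: sum.distrib sum_distrib_left[symmetric] n) (simp add: power2_eq_square)
qed

lemma norm_axial_scaling_diff:
  fixes e e' :: "real ^ 'n"
  assumes "norm e = 1" "norm e' = 1"
  shows "(norm (axial_scaling s e' e - axial_scaling (- s) e e))\<^sup>2 =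
    (s - 1)\<^sup>2 * (e \<bullet> e')\<^sup>2 + (s + 1)\<^sup>2 + 2 * (s\<^sup>2 - 1) * (e \<bullet> e')\<^sup>2"
proof -
  have e: "e \<bullet> e = 1" "e' \<bullet> e' = 1" using assms by (simp_all add: norm_eq_1)
  have "axial_scaling s e' e - axial_scaling (- s) e e = ((s - 1) * (e \<bullet> e')) *\<^sub>R e' + (s + 1) *\<^sub>R e"
    by (simp add: axial_scaling_def e inner_commute[of e' e] algebra_simps)
  then show ?thesis
    unfolding power2_norm_eq_inner
    by (simp only:) (simp add: inner_add_left inner_add_right e inner_commute[of e' e] power2_eq_square algebra_simps)
qed

lemma isCont_eventually_less:
  fixes f :: "'a :: t2_space \<Rightarrow> real"
  assumes "isCont f x" "f x < c"
  shows "\<forall>\<^sub>F z in nhds x. f z < c"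
  using assms unfolding isCont_def tendsto_at_iff_tendsto_nhds by (rule order_tendstoD(2))

lemma axial_scaling_symmetric: "axial_scaling t e x \<bullet> y = x \<bullet> axial_scaling t e y"
  by (simp add: axial_scaling_def inner_add_left inner_add_right inner_commute[of e])

text \<open>\<open>c\<close> is the cosine between the axes. At \<open>c\<^sup>2 = 1\<close> both
  \<open>A\<close> and \<open>D\<close> are \<open>4 * s\<^sup>2\<close> and the bracket is
  \<open>- 2 * (1 - \<delta>) * s\<^sup>2\<close>. Misalignment costs at most
  \<open>3 * p * (1 - c\<^sup>2)\<close>, assumed to consume no more than half of this; the other
  half, times \<open>\<beta>\<close>, absorbs the localization term.\<close>

lemma doubling_trace_negative:
  fixes s p \<delta> N n \<beta> \<Lambda> c :: real
  assumes s: "s \<ge> 0" "s\<^sup>2 = p - 1" and \<delta>: "0 < \<delta>" "\<delta> < 1" and c: "c\<^sup>2 \<le> 1"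
    and \<theta>: "3 * p * (1 - c\<^sup>2) \<le> (1 - \<delta>) * (p - 1)"
    and \<Lambda>: "\<Lambda> \<le> \<beta>" "2 * N * (n + p) < (1 - \<delta>) * (p - 1) * \<Lambda>" and "N \<ge> 0" "\<Lambda> \<ge> 0"
  defines "A \<equiv> (s - 1)\<^sup>2 + (s + 1)\<^sup>2 + 2 * (s\<^sup>2 - 1) * c\<^sup>2"
    and "D \<equiv> (s - 1)\<^sup>2 * c\<^sup>2 + (s + 1)\<^sup>2 + 2 * (s\<^sup>2 - 1) * c\<^sup>2"
  shows "\<beta> * (A - (3 - \<delta>) / 2 * D) + 2 * N * (n + p - 2) < 0"
proof -
  define \<theta> where "\<theta> = 1 - c\<^sup>2"
  have "\<theta> \<ge> 0" using c by (simp add: \<theta>_def)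
  have p1: "p \<ge> 1" using s(2) by (metis diff_ge_0_iff_ge zero_le_power2)
  have "A - (3 - \<delta>) / 2 * D = - (2 * (1 - \<delta>) * s\<^sup>2)
      + \<theta> * ((3 - \<delta>) / 2 * (s - 1)\<^sup>2 + (1 - \<delta>) * (s\<^sup>2 - 1))"
  proof -
    have c': "c\<^sup>2 = 1 - \<theta>" by (simp add: \<theta>_def)
    show ?thesis unfolding A_def D_def c' by (simp add: power2_eq_square field_simps)
  qed
  also have "\<dots> \<le> - (2 * (1 - \<delta>) * s\<^sup>2) + \<theta> * (3 * p)"
  proof (intro add_left_mono mult_left_mono \<open>\<theta> \<ge> 0\<close>)
    have "(s - 1)\<^sup>2 \<le> p" using s by (simp add: power2_diff)
    then have "(3 - \<delta>) / 2 * (s - 1)\<^sup>2 \<le> (3 / 2) * p"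
      using \<delta> p1 by (intro mult_mono) auto
    moreover have "(1 - \<delta>) * (s\<^sup>2 - 1) \<le> 1 * p"
    proof (cases "s\<^sup>2 - 1 \<ge> 0")
      case True
      then show ?thesis using \<delta> s by (intro mult_mono) auto
    next
      case False
      then have "(1 - \<delta>) * (s\<^sup>2 - 1) \<le> 0" using \<delta> by (intro mult_nonneg_nonpos) auto
      then show ?thesis using p1 by simp
    qed
    ultimately show "(3 - \<delta>) / 2 * (s - 1)\<^sup>2 + (1 - \<delta>) * (s\<^sup>2 - 1) \<le> 3 * p" using p1 by linarith
  qed
  also have "\<dots> \<le> - ((1 - \<delta>) * (p - 1))"
    using \<theta> unfolding s(2) by (simp add: \<theta>_def algebra_simps)
  finally have AD: "A - (3 - \<delta>) / 2 * D \<le> - ((1 - \<delta>) * (p - 1))" .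
  have "\<beta> * (A - (3 - \<delta>) / 2 * D) \<le> \<beta> * (- ((1 - \<delta>) * (p - 1)))"
    using AD \<Lambda>(1) \<open>\<Lambda> \<ge> 0\<close> by (intro mult_left_mono) auto
  also have "\<dots> = - ((1 - \<delta>) * (p - 1) * \<beta>)" by simp
  also have "\<dots> \<le> - ((1 - \<delta>) * (p - 1) * \<Lambda>)"
    unfolding neg_le_iff_le using \<Lambda>(1) \<delta> p1 by (intro mult_left_mono) auto
  also have "\<dots> < - (2 * N * (n + p))" using \<Lambda>(2) by (simp only: neg_less_iff_less)
  also have "\<dots> \<le> - (2 * N * (n + p - 2))"
    unfolding neg_le_iff_le using \<open>N \<ge> 0\<close> by (intro mult_left_mono) auto
  finally show ?thesis by simp
qed

text \<open>\<open>w\<close> is the difference of the two maximum points and \<open>v\<close> the displacement caused by the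
  localization term; the two gradients are \<open>\<beta> w + 2 N v\<close> and \<open>\<beta> w\<close>, hence almost parallel.\<close>

lemma gradients_almost_parallel:
  fixes v w :: "'a :: real_inner"
  assumes w: "w \<noteq> 0" and v: "norm v \<le> 1 / 4" and N: "N > 0" and G: "G = \<beta> * norm w" "N \<le> G"
  defines "\<eta> \<equiv> \<beta> *\<^sub>R w + (2 * N) *\<^sub>R v"
  shows "\<eta> \<noteq> 0" "(1 - (sgn w \<bullet> sgn \<eta>)\<^sup>2) * G\<^sup>2 \<le> N\<^sup>2"
proof -
  define V where "V = (2 * N) *\<^sub>R v"
  define e where "e = sgn w"
  have e: "e \<bullet> e = 1" "norm e = 1" using w by (simp_all add: e_def norm_sgn flip: norm_eq_1)
  have \<eta>: "\<eta> = G *\<^sub>R e + V" using w by (simp add: \<eta>_def V_def e_def G(1) sgn_div_norm)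
  have V: "norm V \<le> N / 2" using v N by (simp add: V_def)
  have "norm (G *\<^sub>R e) = G" using e G N by simp
  then have \<eta>_ge: "norm \<eta> \<ge> G / 2"
    using norm_diff_ineq[of "G *\<^sub>R e" V] V G(2) by (simp add: \<eta>)
  then show \<eta>0: "\<eta> \<noteq> 0" using G N by auto
  \<comment> \<open>This is the squared length of the component orthogonal to \<open>e\<close>,
    which the multiple \<open>G\<close> of \<open>e\<close> does not affect.\<close>
  have "(norm \<eta>)\<^sup>2 - (e \<bullet> \<eta>)\<^sup>2 = (norm V)\<^sup>2 - (e \<bullet> V)\<^sup>2"
    unfolding \<eta> power2_norm_eq_inner inner_add_left inner_add_right inner_scaleR_left inner_scaleR_right
      e inner_commute[of V e]
    by (simp add: power2_eq_square algebra_simps)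
  moreover have "(norm V)\<^sup>2 \<le> (N / 2)\<^sup>2" using V by (intro power_mono) auto
  ultimately have *: "(norm \<eta>)\<^sup>2 - (e \<bullet> \<eta>)\<^sup>2 \<le> (N / 2)\<^sup>2" by (smt (verit) zero_le_power2)
  define \<theta> where "\<theta> = 1 - (e \<bullet> sgn \<eta>)\<^sup>2"
  have "\<bar>e \<bullet> sgn \<eta>\<bar> \<le> 1" using Cauchy_Schwarz_ineq2[of e "sgn \<eta>"] e \<eta>0 by (simp add: norm_sgn)
  then have "\<theta> \<ge> 0" by (simp add: \<theta>_def abs_square_le_1)
  have "e \<bullet> \<eta> = norm \<eta> * (e \<bullet> sgn \<eta>)" using \<eta>0 by (simp add: sgn_div_norm)
  then have "\<theta> * (norm \<eta>)\<^sup>2 = (norm \<eta>)\<^sup>2 - (e \<bullet> \<eta>)\<^sup>2"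
    by (simp add: \<theta>_def power_mult_distrib algebra_simps)
  moreover have "\<theta> * (G / 2)\<^sup>2 \<le> \<theta> * (norm \<eta>)\<^sup>2"
    using \<eta>_ge G N \<open>\<theta> \<ge> 0\<close> by (intro mult_left_mono power_mono) auto
  ultimately have "\<theta> * (G / 2)\<^sup>2 \<le> (N / 2)\<^sup>2" using * by simp
  then have "\<theta> * G\<^sup>2 \<le> N\<^sup>2" by (simp add: power_divide)
  then show "(1 - (sgn w \<bullet> sgn \<eta>)\<^sup>2) * G\<^sup>2 \<le> N\<^sup>2" by (simp add: \<theta>_def e_def)
qed

text \<open>Only the value of the Laplacian at the origin, where \<open>S\<close> vanishes, is needed.\<close>

lemma laplacian_upper_barrier:
  fixes d T :: "real ^ 'n \<Rightarrow> real ^ 'n" and w v :: "real ^ 'n" and \<kappa> \<mu> N c :: real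
  assumes d: "bounded_linear d" and dsym: "\<And>x y. d x \<bullet> y = x \<bullet> d y" and T: "bounded_linear T"
  defines "S \<equiv> \<lambda>z. (norm (d z + w))\<^sup>2 + (- (norm w)\<^sup>2)"
  defines "P \<equiv> \<lambda>z. (\<kappa> * S z + \<mu> * (S z * S z)) + (N * (norm (T z + v))\<^sup>2 + c)"
  shows "real_polynomial_function P"
    and "laplacian P 0 = 2 * \<kappa> * (\<Sum>i\<in>UNIV. (norm (d (axis i 1)))\<^sup>2) + 8 * \<mu> * (norm (d w))\<^sup>2
      + 2 * N * (\<Sum>i\<in>UNIV. (norm (T (axis i 1)))\<^sup>2)"
proof -
  have Q: "real_polynomial_function (\<lambda>z. (norm (d z + w))\<^sup>2)"
    "real_polynomial_function (\<lambda>z. (norm (T z + v))\<^sup>2)"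
    by (intro polynomial_affine[OF polynomial_norm_power2] d T)+
  have S: "real_polynomial_function S"
    unfolding S_def by (intro polynomial_add polynomial_const Q)
  have SS: "real_polynomial_function (\<lambda>z. S z * S z)" by (intro polynomial_mult S)
  have P1: "real_polynomial_function (\<lambda>z. \<kappa> * S z + \<mu> * (S z * S z))"
    and P2: "real_polynomial_function (\<lambda>z. N * (norm (T z + v))\<^sup>2 + c)"
    by (intro polynomial_add polynomial_mult polynomial_const S Q)+
  show "real_polynomial_function P" unfolding P_def by (rule polynomial_add[OF P1 P2])
  have lapS: "laplacian S 0 = 2 * (\<Sum>i\<in>UNIV. (norm (d (axis i 1)))\<^sup>2)"
    unfolding S_def laplacian_add[OF Q(1) polynomial_const] laplacian_norm_affine[OF d] by simp
  have d0: "d 0 = 0" using d by (simp add: linear_0 bounded_linear.linear)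
  have S0: "S 0 = 0" by (simp add: S_def d0)
  have "gradient S 0 = 2 *\<^sub>R d w"
  proof -
    have "gradient S 0 \<bullet> x = (2 *\<^sub>R d w) \<bullet> x" for x
      unfolding S_def gradient_add[OF Q(1) polynomial_const] inner_add_left gradient_norm_affine[OF d]
      by (simp add: d0 dsym)
    then show ?thesis by (metis vector_eq_rdot)
  qed
  \<comment> \<open>As \<open>S 0 = 0\<close>, only twice the squared norm of the gradient survives
    in the Laplacian of the square.\<close>
  then have "laplacian (\<lambda>z. S z * S z) 0 = 8 * (norm (d w))\<^sup>2"
    unfolding laplacian_mult[OF S S] S0 by (simp add: dot_square_norm)
  moreover have "laplacian (\<lambda>z. \<kappa> * S z + \<mu> * (S z * S z)) 0 =
      \<kappa> * laplacian S 0 + \<mu> * laplacian (\<lambda>z. S z * S z) 0"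
    using laplacian_add[OF polynomial_mult[OF polynomial_const S] polynomial_mult[OF polynomial_const SS], of \<kappa> \<mu> 0]
    unfolding laplacian_cmult[OF S] laplacian_cmult[OF SS] .
  moreover have "laplacian (\<lambda>z. N * (norm (T z + v))\<^sup>2 + c) 0 = N * (2 * (\<Sum>i\<in>UNIV. (norm (T (axis i 1)))\<^sup>2))"
    using laplacian_add[OF polynomial_mult[OF polynomial_const Q(2)] polynomial_const, of N c 0]
    unfolding laplacian_cmult[OF Q(2)] laplacian_norm_affine[OF T] by simp
  ultimately show "laplacian P 0 = 2 * \<kappa> * (\<Sum>i\<in>UNIV. (norm (d (axis i 1)))\<^sup>2) + 8 * \<mu> * (norm (d w))\<^sup>2
      + 2 * N * (\<Sum>i\<in>UNIV. (norm (T (axis i 1)))\<^sup>2)"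
    unfolding P_def laplacian_add[OF P1 P2] lapS by simp
qed

text \<open>Replacing both functions on a small sphere by harmonic polynomials, which they lie below at the
  centre up to \<open>\<tau> r\<^sup>2\<close>, reduces the contradiction to the maximum principle for polynomials.\<close>

lemma frozen_sum_contradiction:
  fixes F G P :: "real ^ 'n \<Rightarrow> real"
  assumes F: "continuous_on UNIV F" and G: "continuous_on UNIV G" and P: "real_polynomial_function P"
    and FG0: "P 0 = F 0 + G 0" and lap: "laplacian P 0 < 0"
    and le: "\<forall>\<^sub>F z in nhds 0. F z + G z \<le> P z"
    and Fsub: "\<And>\<tau>. \<tau> > 0 \<Longrightarrow> \<exists>\<rho>>0. \<forall>r h. 0 < r \<longrightarrow> r < \<rho> \<longrightarrow> real_polynomial_function h \<longrightarrow>
      (\<forall>z. laplacian h z = 0) \<longrightarrow> (\<forall>z. norm z = r \<longrightarrow> F z \<le> h z) \<longrightarrow> F 0 \<le> h 0 + \<tau> * r\<^sup>2"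
    and Gsub: "\<And>\<tau>. \<tau> > 0 \<Longrightarrow> \<exists>\<rho>>0. \<forall>r h. 0 < r \<longrightarrow> r < \<rho> \<longrightarrow> real_polynomial_function h \<longrightarrow>
      (\<forall>z. laplacian h z = 0) \<longrightarrow> (\<forall>z. norm z = r \<longrightarrow> G z \<le> h z) \<longrightarrow> G 0 \<le> h 0 + \<tau> * r\<^sup>2"
  shows False
proof -
  define m where "m = - laplacian P 0 / 2"
  define n where "n = real CARD('n)"
  have "m > 0" "n > 0" using lap by (auto simp: m_def n_def)
  define \<beta> where "\<beta> = m / (4 * n)"
  have \<beta>: "\<beta> > 0" "2 * n * \<beta> < m" using \<open>m > 0\<close> \<open>n > 0\<close> by (auto simp: \<beta>_def)
  have "isCont (laplacian P) 0"
    using polynomial_continuous_on[OF polynomial_laplacian[OF P], of UNIV]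
    by (simp add: continuous_on_eq_continuous_at)
  moreover have "laplacian P 0 < - m" using lap by (simp add: m_def)
  ultimately have "\<forall>\<^sub>F z in nhds 0. laplacian P z < - m"
    by (rule isCont_eventually_less)
  with le have "\<forall>\<^sub>F z in nhds 0. F z + G z \<le> P z \<and> laplacian P z < - m" by (rule eventually_conj)
  then obtain \<rho>3 where \<rho>3: "\<rho>3 > 0" "\<And>z. norm z < \<rho>3 \<Longrightarrow> F z + G z \<le> P z \<and> laplacian P z < - m"
    by (auto simp: eventually_nhds_metric dist_norm)
  have "\<beta> / 4 > 0" using \<beta> by simp
  obtain \<rho>1 where \<rho>1: "\<rho>1 > 0" "\<And>r h. 0 < r \<Longrightarrow> r < \<rho>1 \<Longrightarrow> real_polynomial_function h \<Longrightarrow>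
      (\<And>z. laplacian h z = 0) \<Longrightarrow> (\<And>z. norm z = r \<Longrightarrow> F z \<le> h z) \<Longrightarrow> F 0 \<le> h 0 + \<beta> / 4 * r\<^sup>2"
    using Fsub[OF \<open>\<beta> / 4 > 0\<close>] by blast
  obtain \<rho>2 where \<rho>2: "\<rho>2 > 0" "\<And>r h. 0 < r \<Longrightarrow> r < \<rho>2 \<Longrightarrow> real_polynomial_function h \<Longrightarrow>
      (\<And>z. laplacian h z = 0) \<Longrightarrow> (\<And>z. norm z = r \<Longrightarrow> G z \<le> h z) \<Longrightarrow> G 0 \<le> h 0 + \<beta> / 4 * r\<^sup>2"
    using Gsub[OF \<open>\<beta> / 4 > 0\<close>] by blast
  define r where "r = min \<rho>1 (min \<rho>2 \<rho>3) / 2"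
  have r: "r > 0" "r < \<rho>1" "r < \<rho>2" "r < \<rho>3" using \<rho>1(1) \<rho>2(1) \<rho>3(1) by (auto simp: r_def)
  define \<epsilon> where "\<epsilon> = \<beta> * r\<^sup>2 / 8"
  have \<epsilon>: "\<epsilon> > 0" using \<beta> r by (simp add: \<epsilon>_def)
  obtain h where h: "real_polynomial_function h" "\<And>x. laplacian h x = 0"
    "\<And>x. norm x = r \<Longrightarrow> F x \<le> h x \<and> h x \<le> F x + \<epsilon>"
    using harmonic_approximation_sphere[OF continuous_on_subset[OF F subset_UNIV] \<epsilon>, of r] by blast
  obtain k where k: "real_polynomial_function k" "\<And>x. laplacian k x = 0"
    "\<And>x. norm x = r \<Longrightarrow> G x \<le> k x \<and> k x \<le> G x + \<epsilon>"
    using harmonic_approximation_sphere[OF continuous_on_subset[OF G subset_UNIV] \<epsilon>, of r] by blast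
  have F0: "F 0 \<le> h 0 + \<beta> / 4 * r\<^sup>2" using h r by (intro \<rho>1(2)) auto
  have G0: "G 0 \<le> k 0 + \<beta> / 4 * r\<^sup>2" using k r by (intro \<rho>2(2)) auto
  \<comment> \<open>On the sphere the two approximation errors are offset by
    \<open>- 2 * \<epsilon>\<close>; inside, \<open>\<beta>\<close> is small enough to keep
    \<open>W\<close> strictly subharmonic. At 0 the gain \<open>\<beta> * r\<^sup>2\<close> exceeds
    the losses: \<open>\<beta> / 4 * r\<^sup>2\<close> from each of \<open>F\<close> and
    \<open>G\<close>, and \<open>2 * \<epsilon>\<close>, which is again
    \<open>\<beta> / 4 * r\<^sup>2\<close>.\<close>
  define W where "W = (\<lambda>z. (h z + k z) + ((- 1) * P z + ((- \<beta>) * (norm z)\<^sup>2 + (\<beta> * r\<^sup>2 - 2 * \<epsilon>))))"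
  have q: "real_polynomial_function (\<lambda>z :: real ^ 'n. (- \<beta>) * (norm z)\<^sup>2)"
    "real_polynomial_function (\<lambda>z :: real ^ 'n. (- \<beta>) * (norm z)\<^sup>2 + (\<beta> * r\<^sup>2 - 2 * \<epsilon>))"
    "real_polynomial_function (\<lambda>z. (- 1) * P z)"
    "real_polynomial_function (\<lambda>z. (- 1) * P z + ((- \<beta>) * (norm z)\<^sup>2 + (\<beta> * r\<^sup>2 - 2 * \<epsilon>)))"
    "real_polynomial_function (\<lambda>z. h z + k z)"
    by (intro polynomial_add polynomial_mult polynomial_const polynomial_norm_power2 P h k)+
  have W: "real_polynomial_function W" unfolding W_def by (intro polynomial_add q)
  have lapW: "laplacian W z = - laplacian P z - 2 * n * \<beta>" for z
    unfolding W_def laplacian_add[OF q(5,4)] laplacian_add[OF h(1) k(1)] laplacian_add[OF q(3,2)]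
      laplacian_add[OF q(1) polynomial_const] laplacian_cmult[OF P] laplacian_cmult[OF polynomial_norm_power2]
      laplacian_norm_power2 h(2) k(2) laplacian_const
    by (simp add: n_def)
  have "W 0 \<le> 0"
  proof (rule subharmonic_max_principle[OF W r(1)])
    show "laplacian W x > 0" if "norm x < r" for x
      using \<rho>3(2)[of x] that r \<beta> by (simp add: lapW)
    show "W x \<le> 0" if "norm x = r" for x
      using \<rho>3(2)[of x] h(3)[OF that] k(3)[OF that] that r by (simp add: W_def)
  qed (use r in auto)
  then have "h 0 + k 0 \<le> F 0 + G 0 - \<beta> * r\<^sup>2 + 2 * \<epsilon>" by (simp add: W_def FG0)
  moreover have "\<beta> * r\<^sup>2 > 0" using \<beta> r by simp
  ultimately show False using F0 G0 unfolding \<epsilon>_def by linarith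
qed

text \<open>The penalty is written as a power of the squared distance because the latter is a
  polynomial: replacing the power by a quadratic in it near the maximum turns the whole penalty into
  a polynomial barrier.\<close>

lemma two_point_maximum_contradiction:
  fixes u :: "real ^ 'n \<Rightarrow> real" and x0 xh yh :: "real ^ 'n" and p \<delta> l L N :: real
  defines "f \<equiv> sup_convolution l u" and "g \<equiv> sup_convolution l (\<lambda>x. - u x)"
  assumes u: "continuous_on (cball 0 1) u" and sub: "polynomial_subsolution p (ball 0 1) u"
    and sub': "polynomial_subsolution p (ball 0 1) (\<lambda>x. - u x)"
    and p: "1 < p" and \<delta>: "0 < \<delta>" "\<delta> < 1" and l: "l > 0"
    and xh: "xh \<in> ball 0 1" and yh: "yh \<in> ball 0 1"
    and zx: "\<And>z. sup_maximizer l u xh z \<Longrightarrow> z \<in> ball 0 1"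
    and zy: "\<And>z. sup_maximizer l (\<lambda>x. - u x) yh z \<Longrightarrow> z \<in> ball 0 1"
    and ne: "xh \<noteq> yh" and near: "norm (xh - yh) \<le> 1" "norm (xh - x0) \<le> 1 / 4"
    and max: "\<And>x y. x \<in> cball 0 1 \<Longrightarrow> y \<in> cball 0 1 \<Longrightarrow>
      f x + g y - L * ((norm (x - y))\<^sup>2) powr (\<delta> / 2) - N * (norm (x - x0))\<^sup>2
      \<le> f xh + g yh - L * ((norm (xh - yh))\<^sup>2) powr (\<delta> / 2) - N * (norm (xh - x0))\<^sup>2"
    and N: "N > 0" and L: "N \<le> L * \<delta>" "1 \<le> L * \<delta>" "3 * p * N\<^sup>2 \<le> (1 - \<delta>) * (p - 1) * (L * \<delta>)"
      "2 * N * (real CARD('n) + p) < (1 - \<delta>) * (p - 1) * (L * \<delta>)"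
  shows False
proof -
  define s where "s = sqrt (p - 1)"
  define w where "w = xh - yh"
  define v where "v = xh - x0"
  define s0 where "s0 = (norm w)\<^sup>2"
  define a where "a = \<delta> / 2"
  \<comment> \<open>The midpoint of \<open>1 / 4\<close> and \<open>(1 - a) / 2\<close>. Below the
    upper end, the quadratic with coefficients \<open>k1\<close> (the derivative of the penalty in
    the squared distance) and \<open>k2\<close> still dominates the penalty; above the lower end,
    its second derivative along the unit vector \<open>e\<close>,
    \<open>2 * k1 * (1 - 4 * b)\<close>, stays negative.\<close>
  define b where "b = (3 - \<delta>) / 8"
  define k1 where "k1 = L * a * (s0 powr a / s0)"
  define k2 where "k2 = - (k1 * b / s0)"
  define \<beta> where "\<beta> = 2 * k1"
  define G where "G = \<beta> * norm w"
  define e where "e = sgn w"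
  define \<eta> where "\<eta> = \<beta> *\<^sub>R w + (2 * N) *\<^sub>R v"
  define e' where "e' = sgn \<eta>"
  have u': "continuous_on (cball 0 1) (\<lambda>x. - u x)" using u by (rule continuous_on_minus)
  have w0: "w \<noteq> 0" using ne by (simp add: w_def)
  have s0: "s0 > 0" using w0 by (simp add: s0_def)
  have L0: "L > 0" using L(2) \<delta> by (smt (verit) mult_nonpos_nonneg)
  have k1: "k1 > 0" using L0 \<delta> s0 by (simp add: k1_def a_def)
  \<comment> \<open>\<open>G\<close> equals \<open>L * \<delta>\<close> times \<open>norm w\<close>
    to the power \<open>\<delta> - 1\<close>, a negative exponent, and
    \<open>norm w \<le> 1\<close>.\<close>
  have G_ge: "G \<ge> L * \<delta>"
  proof -
    have n: "norm w > 0" "norm w \<le> 1" using w0 near(1) by (auto simp: w_def)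
    have "norm w = norm w powr 1" using n by simp
    also have "\<dots> \<le> norm w powr \<delta>" using n \<delta> by (intro powr_mono') auto
    also have "\<dots> = s0 powr a"
      using n by (simp add: s0_def a_def powr_powr flip: powr_numeral)
    finally have "1 \<le> s0 powr a / norm w" using n by simp
    then have "L * \<delta> * 1 \<le> L * \<delta> * (s0 powr a / norm w)"
      using L(2) by (intro mult_left_mono) auto
    also have "\<dots> = G"
      using n by (simp add: G_def \<beta>_def k1_def a_def s0_def power2_eq_square field_simps)
    finally show ?thesis by simp
  qed
  have \<beta>_ge: "\<beta> \<ge> L * \<delta>"
  proof -
    have "G \<le> \<beta> * 1" unfolding G_def using near(1) k1 by (intro mult_left_mono) (auto simp: \<beta>_def w_def)
    then show ?thesis using G_ge by simp
  qed
  note par = gradients_almost_parallel[of w v N G \<beta>, OF w0 near(2)[folded v_def] N G_def,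
      folded \<eta>_def, folded e_def e'_def]
  have e: "norm e = 1" using w0 by (simp add: e_def norm_sgn)
  have \<eta>0: "\<eta> \<noteq> 0" and \<theta>: "(1 - (e \<bullet> e')\<^sup>2) * G\<^sup>2 \<le> N\<^sup>2" using par L(1) G_ge by auto
  have e': "norm e' = 1" using \<eta>0 by (simp add: e'_def norm_sgn)
  have c1: "(e \<bullet> e')\<^sup>2 \<le> 1"
    using Cauchy_Schwarz_ineq2[of e e'] e e' by (simp add: abs_square_le_1)

  have "0 < a" "a < 1" "2 * b < 1 - a" using \<delta> by (auto simp: a_def b_def field_simps)
  from powr_second_order_bound[OF this] obtain \<epsilon> where \<epsilon>: "\<epsilon> > 0"
    "\<And>v. \<bar>v\<bar> < \<epsilon> \<Longrightarrow> (1 + v) powr a \<le> 1 + a * v - a * b * v\<^sup>2" by blast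
  have powr_le: "L * \<sigma> powr a \<le> L * s0 powr a + k1 * (\<sigma> - s0) + k2 * ((\<sigma> - s0) * (\<sigma> - s0))"
    if "\<bar>\<sigma> - s0\<bar> < \<epsilon> * s0" "\<sigma> \<ge> 0" for \<sigma>
  proof -
    have "\<bar>(\<sigma> - s0) / s0\<bar> < \<epsilon>" using that s0 by (simp add: divide_less_eq)
    from \<epsilon>(2)[OF this] have "(\<sigma> / s0) powr a \<le> 1 + a * ((\<sigma> - s0) / s0) - a * b * ((\<sigma> - s0) / s0)\<^sup>2"
      using s0 by (simp add: diff_divide_distrib)
    then have "L * s0 powr a * (\<sigma> / s0) powr a \<le>
        L * s0 powr a * (1 + a * ((\<sigma> - s0) / s0) - a * b * ((\<sigma> - s0) / s0)\<^sup>2)"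
      using L0 by (intro mult_left_mono) auto
    also have "\<dots> = L * s0 powr a + k1 * (\<sigma> - s0) + k2 * ((\<sigma> - s0) * (\<sigma> - s0))"
      using s0 by (simp add: k1_def k2_def power2_eq_square field_simps)
    also have "L * s0 powr a * (\<sigma> / s0) powr a = L * \<sigma> powr a"
      using s0 that by (simp add: powr_divide)
    finally show ?thesis .
  qed
  have powr_le': "L * \<sigma> powr a \<le> L * s0 powr a + k1 * (\<sigma> - s0)"
    if "\<bar>\<sigma> - s0\<bar> < \<epsilon> * s0" "\<sigma> \<ge> 0" for \<sigma>
  proof -
    have "k2 \<le> 0" using k1 s0 \<delta> by (simp add: k2_def b_def)
    then have "k2 * ((\<sigma> - s0) * (\<sigma> - s0)) \<le> 0" by (intro mult_nonpos_nonneg) auto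
    then show ?thesis using powr_le[OF that] by linarith
  qed
  have max': "f x + g y \<le> f xh + g yh + (L * ((norm (x - y))\<^sup>2) powr a - L * s0 powr a)
      + (N * (norm (x - x0))\<^sup>2 - N * (norm v)\<^sup>2)" if "x \<in> cball 0 1" "y \<in> cball 0 1" for x y
    using max[OF that] unfolding a_def s0_def w_def v_def by linarith

  have close: "\<forall>\<^sub>F z in nhds 0. \<bar>(norm (S z + w))\<^sup>2 - s0\<bar> < \<epsilon> * s0"
    if "bounded_linear S" for S :: "real ^ 'n \<Rightarrow> real ^ 'n"
  proof -
    have S0: "S 0 = 0" using that by (simp add: linear_0 bounded_linear.linear)
    have "isCont (\<lambda>z. \<bar>(norm (S z + w))\<^sup>2 - s0\<bar>) 0"
      by (intro continuous_intros linear_continuous_at that)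
    moreover have "\<bar>(norm (S 0 + w))\<^sup>2 - s0\<bar> < \<epsilon> * s0" using \<epsilon>(1) s0 by (simp add: S0 s0_def)
    ultimately show ?thesis by (rule isCont_eventually_less)
  qed
  have inside: "\<forall>\<^sub>F z in nhds 0. c + S z \<in> cball 0 1"
    if "bounded_linear S" "c \<in> ball 0 1" for S :: "real ^ 'n \<Rightarrow> real ^ 'n" and c
  proof -
    have S0: "S 0 = 0" using that by (simp add: linear_0 bounded_linear.linear)
    have "isCont (\<lambda>z. norm (c + S z)) 0"
      by (intro continuous_intros linear_continuous_at that)
    moreover have "norm (c + S 0) < 1" using that(2) by (simp add: S0)
    ultimately have "\<forall>\<^sub>F z in nhds 0. norm (c + S z) < 1"
      by (rule isCont_eventually_less)
    then show ?thesis by eventually_elim simp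
  qed
  have shift: "\<forall>\<^sub>F z in nhds c. Q z" if "\<forall>\<^sub>F z in nhds 0. Q (c + z)" for Q and c :: "real ^ 'n"
  proof -
    have "filterlim (\<lambda>z. z - c) (nhds (c - c)) (nhds c)" by (intro tendsto_intros filterlim_ident)
    then have "filterlim (\<lambda>z. z - c) (nhds 0) (nhds c)" by simp
    from eventually_compose_filterlim[OF that this] show ?thesis by simp
  qed

  have zh: "z = xh + (1 / (2 * l)) *\<^sub>R \<eta>" if z: "sup_maximizer l u xh z" for z
  proof -
    let ?\<theta> = "\<lambda>x. k1 * (norm (x - yh))\<^sup>2 + N * (norm (x - x0))\<^sup>2"
    have \<theta>: "real_polynomial_function ?\<theta>" by (intro polynomial_add polynomial_dist_power2)
    have "local_max_at (\<lambda>x. f x - ?\<theta> x) xh"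
      unfolding local_max_at_def
    proof (rule shift)
      show "\<forall>\<^sub>F z in nhds 0. f (xh + z) - ?\<theta> (xh + z) \<le> f xh - ?\<theta> xh"
        using close[OF bounded_linear_ident] inside[OF bounded_linear_ident xh]
      proof eventually_elim
        case (elim z)
        have zw: "z + w = xh + z - yh" by (simp add: w_def)
        from max'[OF elim(2), of yh] powr_le'[OF elim(1)] yh show ?case
          unfolding zw s0_def w_def v_def by (simp add: algebra_simps)
      qed
    qed
    from sup_convolution_touching(1)[OF u sub z zx[OF z] \<theta> this[unfolded f_def]]
    have "(2 * l) *\<^sub>R (z - xh) = \<eta>"
      by (simp add: gradient_add polynomial_dist_power2 gradient_dist_power2 \<eta>_def \<beta>_def w_def v_def)
    then have "(1 / (2 * l)) *\<^sub>R \<eta> = (1 / (2 * l)) *\<^sub>R (2 * l) *\<^sub>R (z - xh)" by simp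
    also have "\<dots> = z - xh" using l by simp
    finally have "(1 / (2 * l)) *\<^sub>R \<eta> = z - xh" .
    then show ?thesis by simp
  qed
  have wh: "z = yh + (1 / (2 * l)) *\<^sub>R (- (\<beta> *\<^sub>R w))" if z: "sup_maximizer l (\<lambda>x. - u x) yh z" for z
  proof -
    let ?\<theta> = "\<lambda>y. k1 * (norm (y - xh))\<^sup>2"
    have "local_max_at (\<lambda>y. g y - ?\<theta> y) yh"
      unfolding local_max_at_def
    proof (rule shift)
      show "\<forall>\<^sub>F z in nhds 0. g (yh + z) - ?\<theta> (yh + z) \<le> g yh - ?\<theta> yh"
        using close[OF bounded_linear_minus[OF bounded_linear_ident]] inside[OF bounded_linear_ident yh]
      proof eventually_elim
        case (elim z)
        have zw: "- z + w = xh - (yh + z)" by (simp add: w_def)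
        from max'[OF _ elim(2), of xh] powr_le'[OF elim(1)] xh show ?case
          unfolding zw s0_def w_def v_def by (simp add: algebra_simps norm_minus_commute[of _ xh])
      qed
    qed
    from sup_convolution_touching(1)[OF u' sub' z zy[OF z] polynomial_dist_power2 this[unfolded g_def]]
    have "(2 * l) *\<^sub>R (z - yh) = - (\<beta> *\<^sub>R w)"
      by (simp add: gradient_dist_power2 \<beta>_def w_def algebra_simps)
    then have "(1 / (2 * l)) *\<^sub>R (- (\<beta> *\<^sub>R w)) = (1 / (2 * l)) *\<^sub>R (2 * l) *\<^sub>R (z - yh)" by simp
    also have "\<dots> = z - yh" using l by simp
    finally have "(1 / (2 * l)) *\<^sub>R (- (\<beta> *\<^sub>R w)) = z - yh" .
    then show ?thesis by simp
  qed
  have ss: "s\<^sup>2 = p - 1" "(- s)\<^sup>2 = p - 1" "s \<ge> 0" using p by (auto simp: s_def)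

  let ?T = "axial_scaling s e'" and ?R = "axial_scaling (- s) e"
  define F where "F = (\<lambda>z. f (xh + ?T z))"
  define K where "K = (\<lambda>z. g (yh + ?R z))"
  have T0: "?T 0 = 0" "?R 0 = 0" by (auto simp: axial_scaling_def)
  have cont: "continuous_on UNIV F" "continuous_on UNIV K"
    unfolding F_def K_def f_def g_def
    by (intro continuous_on_compose2[OF continuous_on_sup_convolution[OF u l, of UNIV]]
        continuous_on_compose2[OF continuous_on_sup_convolution[OF u' l, of UNIV]]
        continuous_intros linear_continuous_on bounded_linear_axial_scaling; simp)+
  have Fsub: "\<exists>\<rho>>0. \<forall>r h. 0 < r \<longrightarrow> r < \<rho> \<longrightarrow> real_polynomial_function h \<longrightarrow>
      (\<forall>z. laplacian h z = 0) \<longrightarrow> (\<forall>z. norm z = r \<longrightarrow> F z \<le> h z) \<longrightarrow> F 0 \<le> h 0 + \<tau> * r\<^sup>2"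
    if "\<tau> > 0" for \<tau>
  proof -
    define z where "z = xh + (1 / (2 * l)) *\<^sub>R \<eta>"
    have zm: "sup_maximizer l u xh z" using sup_maximizer_exists[OF u] zh unfolding z_def by metis
    have "z \<noteq> xh" using \<eta>0 l by (simp add: z_def)
    from frozen_comparison[OF u sub l p ss(1) that zh[folded z_def] zx[OF zm] this]
    have *: "\<exists>\<rho>>0. \<forall>r h. 0 < r \<longrightarrow> r < \<rho> \<longrightarrow> real_polynomial_function h \<longrightarrow> (\<forall>z. laplacian h z = 0) \<longrightarrow>
      (\<forall>za. norm za = r \<longrightarrow> f (xh + axial_scaling s (sgn (z - xh)) za) \<le> h za) \<longrightarrow>
      f xh \<le> h 0 + \<tau> * r\<^sup>2" unfolding f_def .
    have "sgn (z - xh) = e'" using l by (simp add: z_def e'_def sgn_scaleR)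
    with * show ?thesis unfolding F_def T0 by simp
  qed
  have Ksub: "\<exists>\<rho>>0. \<forall>r h. 0 < r \<longrightarrow> r < \<rho> \<longrightarrow> real_polynomial_function h \<longrightarrow>
      (\<forall>z. laplacian h z = 0) \<longrightarrow> (\<forall>z. norm z = r \<longrightarrow> K z \<le> h z) \<longrightarrow> K 0 \<le> h 0 + \<tau> * r\<^sup>2"
    if "\<tau> > 0" for \<tau>
  proof -
    define z where "z = yh + (1 / (2 * l)) *\<^sub>R (- (\<beta> *\<^sub>R w))"
    have zm: "sup_maximizer l (\<lambda>x. - u x) yh z" using sup_maximizer_exists[OF u'] wh unfolding z_def by metis
    have "z \<noteq> yh" using k1 w0 l by (simp add: z_def \<beta>_def)
    from frozen_comparison[OF u' sub' l p ss(2) that wh[folded z_def] zy[OF zm] this]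
    have *: "\<exists>\<rho>>0. \<forall>r h. 0 < r \<longrightarrow> r < \<rho> \<longrightarrow> real_polynomial_function h \<longrightarrow> (\<forall>z. laplacian h z = 0) \<longrightarrow>
      (\<forall>za. norm za = r \<longrightarrow> g (yh + axial_scaling (- s) (sgn (z - yh)) za) \<le> h za) \<longrightarrow>
      g yh \<le> h 0 + \<tau> * r\<^sup>2" unfolding g_def .
    have "z - yh = (- (\<beta> / (2 * l))) *\<^sub>R w" by (simp add: z_def)
    moreover have "sgn (- (\<beta> / (2 * l))) = - 1" using k1 l by (simp add: \<beta>_def)
    ultimately have "sgn (z - yh) = - e" by (simp only: sgn_scaleR e_def) simp
    with * show ?thesis unfolding K_def T0 by (simp add: axial_scaling_minus)
  qed

  define d where "d = (\<lambda>z. ?T z - ?R z)"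
  have d: "bounded_linear d" unfolding d_def by (intro bounded_linear_sub bounded_linear_axial_scaling)
  have dsym: "d x \<bullet> y = x \<bullet> d y" for x y
    by (simp add: d_def inner_diff_left inner_diff_right axial_scaling_symmetric)
  define S where "S = (\<lambda>z. (norm (d z + w))\<^sup>2 + (- (norm w)\<^sup>2))"
  define P where "P = (\<lambda>z. (k1 * S z + k2 * (S z * S z)) +
    (N * (norm (?T z + v))\<^sup>2 + (f xh + g yh - N * (norm v)\<^sup>2)))"
  have barrier: "real_polynomial_function P"
    "laplacian P 0 = 2 * k1 * (\<Sum>i\<in>UNIV. (norm (d (axis i 1)))\<^sup>2) + 8 * k2 * (norm (d w))\<^sup>2
      + 2 * N * (\<Sum>i\<in>UNIV. (norm (?T (axis i 1)))\<^sup>2)"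
    unfolding P_def S_def by (rule laplacian_upper_barrier[OF d dsym bounded_linear_axial_scaling])+
  have "laplacian P 0 < 0"
  proof -
    let ?c = "e \<bullet> e'"
    have G0: "G > 0" using L(2) G_ge by linarith
    \<comment> \<open>The squared sine of the angle is at most \<open>N\<^sup>2 / G\<^sup>2\<close>,
      and \<open>G\<^sup>2\<close> is at least \<open>L * \<delta>\<close> because \<open>G\<close>
      is at least both 1 and \<open>L * \<delta>\<close>.\<close>
    have "3 * p * (1 - ?c\<^sup>2) * G\<^sup>2 \<le> 3 * p * N\<^sup>2"
      using mult_left_mono[OF \<theta>, of "3 * p"] p by (simp add: mult.assoc)
    also have "\<dots> \<le> (1 - \<delta>) * (p - 1) * (L * \<delta>)" by (rule L(3))
    also have "\<dots> \<le> (1 - \<delta>) * (p - 1) * G\<^sup>2"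
    proof (rule mult_left_mono)
      have "G * 1 \<le> G * G" using L(2) G_ge by (intro mult_left_mono) auto
      then show "L * \<delta> \<le> G\<^sup>2" using G_ge by (simp add: power2_eq_square)
    qed (use \<delta> p in auto)
    finally have \<theta>': "3 * p * (1 - ?c\<^sup>2) \<le> (1 - \<delta>) * (p - 1)"
      using G0 by (simp only: mult_le_cancel_right_pos zero_less_power)
    have dw: "(norm (d w))\<^sup>2 = s0 * (norm (d e))\<^sup>2"
    proof -
      have "w = norm w *\<^sub>R e" using w0 by (simp add: e_def sgn_div_norm)
      then have "d w = norm w *\<^sub>R d e" using d by (metis linear_scale bounded_linear.linear)
      then show ?thesis by (simp add: s0_def power_mult_distrib)
    qed
    have "8 * k2 * (norm (d w))\<^sup>2 = - (\<beta> * ((3 - \<delta>) / 2 * (norm (d e))\<^sup>2))"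
      using s0 by (simp add: dw k2_def \<beta>_def b_def field_simps)
    then have "laplacian P 0 = \<beta> * ((\<Sum>i\<in>UNIV. (norm (d (axis i 1)))\<^sup>2) - (3 - \<delta>) / 2 * (norm (d e))\<^sup>2)
        + 2 * N * (real CARD('n) + p - 2)"
      unfolding barrier(2) sum_norm_axial_scaling[OF e'] ss by (simp add: \<beta>_def algebra_simps)
    also have "\<dots> < 0"
      unfolding d_def sum_norm_axial_scaling_diff[OF e e'] norm_axial_scaling_diff[OF e e']
      by (rule doubling_trace_negative[OF ss(3,1) \<delta> c1 \<theta>' \<beta>_ge L(4)]) (use N L(2) in auto)
    finally show ?thesis .
  qed
  moreover have "P 0 = F 0 + K 0"
    using d by (simp add: P_def S_def F_def K_def T0 linear_0 bounded_linear.linear)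
  moreover have "\<forall>\<^sub>F z in nhds 0. F z + K z \<le> P z"
    using close[OF d] inside[OF bounded_linear_axial_scaling xh, of s e']
      inside[OF bounded_linear_axial_scaling yh, of "- s" e]
  proof eventually_elim
    case (elim z)
    have 1: "xh + ?T z - (yh + ?R z) = d z + w" by (simp add: d_def w_def)
    have 2: "xh + ?T z - x0 = ?T z + v" by (simp add: v_def)
    have S: "S z = (norm (d z + w))\<^sup>2 - s0" by (simp add: S_def s0_def)
    show ?case
      using max'[OF elim(2,3)] powr_le[OF elim(1)] unfolding 1 2 F_def K_def P_def S by simp
  qed
  ultimately show False
    using frozen_sum_contradiction[OF cont barrier(1) _ _ _ Fsub Ksub] by blast
qed

section \<open>Choice of the parameters and conclusion\<close>

lemma sup_maximizer_close:
  assumes z: "sup_maximizer l u x z" and x: "x \<in> cball 0 1"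
    and M: "\<And>x. x \<in> cball 0 1 \<Longrightarrow> \<bar>u x\<bar> \<le> M"
  shows "l * (norm (x - z))\<^sup>2 \<le> 2 * M"
proof -
  have "u x - l * (norm (x - x))\<^sup>2 \<le> u z - l * (norm (x - z))\<^sup>2"
    using z x unfolding sup_maximizer_def by blast
  then show ?thesis using M[OF x] M[of z] z by (auto simp: sup_maximizer_def abs_le_iff)
qed

text \<open>At the maximum the value of \<open>f + g\<close> is at most \<open>2 * M\<close>. The
  factor 32 in \<open>N\<close> then gives \<open>norm (xh - x0) \<le> 1 / 4\<close>, and
  \<open>16 * M \<le> L\<close> gives \<open>norm (xh - yh) \<le> 1 / 8\<close>. With maximizers
  within \<open>1 / 8\<close> of their points, everything stays in radius
  \<open>1/4 + 1/4 + 1/8 + 1/8\<close>, inside the unit ball.\<close>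

lemma oscillation_bound:
  fixes u :: "real ^ 'n \<Rightarrow> real" and x0 y0 :: "real ^ 'n" and p \<delta> L M :: real
  defines "N \<equiv> 32 * M"
  assumes u: "continuous_on (cball 0 1) u" and sub: "polynomial_subsolution p (ball 0 1) u"
    and sub': "polynomial_subsolution p (ball 0 1) (\<lambda>x. - u x)"
    and p: "1 < p" and \<delta>: "0 < \<delta>" "\<delta> < 1"
    and M: "M > 0" "\<And>x. x \<in> cball 0 1 \<Longrightarrow> \<bar>u x\<bar> \<le> M"
    and L: "16 * M \<le> L" "N \<le> L * \<delta>" "1 \<le> L * \<delta>" "3 * p * N\<^sup>2 \<le> (1 - \<delta>) * (p - 1) * (L * \<delta>)"
      "2 * N * (real CARD('n) + p) < (1 - \<delta>) * (p - 1) * (L * \<delta>)"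
    and x0: "x0 \<in> ball 0 (1/4)" and y0: "y0 \<in> ball 0 (1/4)"
  shows "u x0 - u y0 \<le> L * ((norm (x0 - y0))\<^sup>2) powr (\<delta> / 2)"
proof (rule ccontr)
  assume neg: "\<not> ?thesis"
  define m where "m = u x0 - u y0 - L * ((norm (x0 - y0))\<^sup>2) powr (\<delta> / 2)"
  have m: "m > 0" using neg by (simp add: m_def)
  have L0: "L > 0" using L(1) M(1) by linarith
  have "uniformly_continuous_on (cball 0 1) u" by (intro compact_uniformly_continuous u compact_cball)
  then obtain d where d: "d > 0" "\<And>x y. x \<in> cball 0 1 \<Longrightarrow> y \<in> cball 0 1 \<Longrightarrow> dist x y < d \<Longrightarrow> dist (u x) (u y) < m"
    unfolding uniformly_continuous_on_def using m by metis
  \<comment> \<open>The first bound puts maximizers within \<open>1 / 8\<close> of their base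
    points, the second within \<open>d / 2\<close>, where \<open>d\<close> is the modulus of
    continuity of \<open>u\<close> for the excess \<open>m\<close>.\<close>
  define l where "l = max (128 * M) (16 * M / d\<^sup>2)"
  have l: "l > 0" "l \<ge> 128 * M" "l \<ge> 16 * M / d\<^sup>2" using M(1) by (auto simp: l_def)
  have near8: "norm (x - z) \<le> 1 / 8" and near_d: "norm (x - z) < d / 2"
    if "x \<in> cball 0 1" "l * (norm (x - z))\<^sup>2 \<le> 2 * M" for x z :: "real ^ 'n"
  proof -
    have "128 * M * (norm (x - z))\<^sup>2 \<le> 2 * M"
      using mult_right_mono[OF l(2) zero_le_power2, of "norm (x - z)"] that by linarith
    then have "(norm (x - z))\<^sup>2 \<le> (1 / 8)\<^sup>2" using M(1) by (simp add: power_divide)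
    then show "norm (x - z) \<le> 1 / 8" by (rule power2_le_imp_le) simp
    have "16 * M / d\<^sup>2 * (norm (x - z))\<^sup>2 \<le> 2 * M"
      using mult_right_mono[OF l(3) zero_le_power2, of "norm (x - z)"] that by linarith
    then have "8 * (norm (x - z))\<^sup>2 \<le> d\<^sup>2" using M(1) d(1) by (simp add: divide_le_eq mult.commute)
    then have "4 * (norm (x - z))\<^sup>2 < d\<^sup>2" using zero_less_power[OF d(1), of 2] by linarith
    then have "(norm (x - z))\<^sup>2 < (d / 2)\<^sup>2" by (simp add: power_divide)
    then show "norm (x - z) < d / 2" by (rule power2_less_imp_less) (use d(1) in simp)
  qed
  have u': "continuous_on (cball 0 1) (\<lambda>x. - u x)" using u by (rule continuous_on_minus)
  have M': "\<And>x. x \<in> cball 0 1 \<Longrightarrow> \<bar>- u x\<bar> \<le> M" using M(2) by simp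
  define f where "f = sup_convolution l u"
  define g where "g = sup_convolution l (\<lambda>x. - u x)"
  define \<Phi> where "\<Phi> = (\<lambda>q. f (fst q) + g (snd q) - L * ((norm (fst q - snd q))\<^sup>2) powr (\<delta> / 2)
    - N * (norm (fst q - x0))\<^sup>2)"
  have "continuous_on (cball 0 1 \<times> cball 0 1) \<Phi>"
    unfolding \<Phi>_def f_def g_def
    by (intro continuous_intros continuous_on_compose2[OF continuous_on_sup_convolution[OF u l(1), of UNIV]]
        continuous_on_compose2[OF continuous_on_sup_convolution[OF u' l(1), of UNIV]] continuous_on_powr') (use \<delta> in auto)
  from continuous_attains_sup[OF compact_Times[OF compact_cball compact_cball] _ this]
  obtain q where q: "q \<in> cball 0 1 \<times> cball 0 1" "\<And>q'. q' \<in> cball 0 1 \<times> cball 0 1 \<Longrightarrow> \<Phi> q' \<le> \<Phi> q"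
    by auto
  define xh where "xh = fst q"
  define yh where "yh = snd q"
  have xyh: "xh \<in> cball 0 1" "yh \<in> cball 0 1" using q(1) by (auto simp: xh_def yh_def)
  have max: "f x + g y - L * ((norm (x - y))\<^sup>2) powr (\<delta> / 2) - N * (norm (x - x0))\<^sup>2
      \<le> f xh + g yh - L * ((norm (xh - yh))\<^sup>2) powr (\<delta> / 2) - N * (norm (xh - x0))\<^sup>2"
    if "x \<in> cball 0 1" "y \<in> cball 0 1" for x y
    using q(2)[of "(x, y)"] that by (simp add: \<Phi>_def xh_def yh_def)
  have x0': "x0 \<in> cball 0 1" and y0': "y0 \<in> cball 0 1" using x0 y0 by auto
  have "u x0 \<le> f x0" using sup_convolution_ge[OF u x0', of l x0] by (simp add: f_def)
  moreover have "- u y0 \<le> g y0" using sup_convolution_ge[OF u' y0', of l y0] by (simp add: g_def)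
  ultimately have val: "m \<le> f xh + g yh - L * ((norm (xh - yh))\<^sup>2) powr (\<delta> / 2) - N * (norm (xh - x0))\<^sup>2"
    using max[OF x0' y0'] by (simp add: m_def)
  obtain zh where zh: "sup_maximizer l u xh zh" using sup_maximizer_exists[OF u] .
  obtain wh where wh: "sup_maximizer l (\<lambda>x. - u x) yh wh" using sup_maximizer_exists[OF u'] .
  have zwh: "zh \<in> cball 0 1" "wh \<in> cball 0 1" using zh wh by (auto simp: sup_maximizer_def)
  have f_le: "f xh \<le> u zh" using l(1) by (simp add: f_def sup_convolution_eq[OF zh])
  have g_le: "g yh \<le> - u wh" using l(1) by (simp add: g_def sup_convolution_eq[OF wh])
  have Lpos: "L * ((norm (xh - yh))\<^sup>2) powr (\<delta> / 2) \<ge> 0" using L0 by simp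
  have Npos: "N * (norm (xh - x0))\<^sup>2 \<ge> 0" using M(1) by (simp add: N_def)
  have fg: "f xh + g yh \<le> 2 * M" using f_le g_le M(2)[OF zwh(1)] M(2)[OF zwh(2)] by linarith
  have "32 * M * (norm (xh - x0))\<^sup>2 \<le> 2 * M" using val fg Lpos m unfolding N_def by linarith
  then have "(norm (xh - x0))\<^sup>2 \<le> (1 / 4)\<^sup>2" using M(1) by (simp add: power_divide)
  then have xhx0: "norm (xh - x0) \<le> 1 / 4" by (rule power2_le_imp_le) simp
  have "L * ((norm (xh - yh))\<^sup>2) powr (\<delta> / 2) < 2 * M" using val fg Npos m by linarith
  moreover have "16 * M * ((norm (xh - yh))\<^sup>2) powr (\<delta> / 2) \<le> L * ((norm (xh - yh))\<^sup>2) powr (\<delta> / 2)"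
    using L(1) by (intro mult_right_mono) auto
  ultimately have "16 * M * ((norm (xh - yh))\<^sup>2) powr (\<delta> / 2) < 2 * M" by linarith
  then have pw: "((norm (xh - yh))\<^sup>2) powr (\<delta> / 2) < 1 / 8" using M(1) by (simp add: field_simps)
  have xhyh: "norm (xh - yh) \<le> 1 / 8"
  proof (rule ccontr)
    assume *: "\<not> norm (xh - yh) \<le> 1 / 8"
    then have "(1 / 8) powr 1 \<le> (1 / 8 :: real) powr \<delta>" using \<delta> by (intro powr_mono') auto
    also have "\<dots> \<le> norm (xh - yh) powr \<delta>" using * \<delta> by (intro powr_mono2) auto
    also have "\<dots> = ((norm (xh - yh))\<^sup>2) powr (\<delta> / 2)" using * by (simp add: powr_powr flip: powr_numeral)
    finally show False using pw by simp
  qed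
  have "norm xh \<le> norm (xh - x0) + norm x0" using norm_triangle_ineq[of "xh - x0" x0] by simp
  then have nxh: "norm xh < 1 / 2" using xhx0 x0 by simp
  have "norm yh \<le> norm xh + norm (xh - yh)" using norm_triangle_ineq4[of xh "xh - yh"] by simp
  then have nyh: "norm yh < 5 / 8" using nxh xhyh by simp
  have inball: "z \<in> ball 0 1" if "norm x < 5 / 8" "norm (x - z) \<le> 1 / 8" for x z :: "real ^ 'n"
    using norm_triangle_ineq4[of x "x - z"] that by simp
  have ne: "xh \<noteq> yh"
  proof
    \<comment> \<open>On the diagonal the penalty is not differentiable. There both maximizers lie
      within \<open>d / 2\<close> of the same point, so \<open>u\<close> differs between them by
      less than \<open>m\<close>, the least possible value at the maximum.\<close>
    assume eq: "xh = yh"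
    have "m \<le> u zh - u wh" using val f_le g_le Lpos Npos by linarith
    moreover have "norm (xh - zh) < d / 2" "norm (xh - wh) < d / 2"
      using near_d[OF xyh(1)] sup_maximizer_close[OF zh xyh(1) M(2)] sup_maximizer_close[OF wh xyh(2) M'] eq
      by auto
    then have "dist zh wh < d" using dist_triangle2[of zh wh xh] by (simp add: dist_norm norm_minus_commute)
    then have "dist (u zh) (u wh) < m" by (rule d(2)[OF zwh])
    ultimately show False by (simp add: dist_real_def)
  qed
  show False
  proof (rule two_point_maximum_contradiction[OF u sub sub' p \<delta> l(1) _ _ _ _ ne _ xhx0 _ _ L(2-5)])
    show "xh \<in> ball 0 1" "yh \<in> ball 0 1" using nxh nyh by auto
    show "z \<in> ball 0 1" if "sup_maximizer l u xh z" for z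
      using inball[OF _ near8[OF xyh(1) sup_maximizer_close[OF that xyh(1) M(2)]]] nxh by simp
    show "z \<in> ball 0 1" if "sup_maximizer l (\<lambda>x. - u x) yh z" for z
      using inball[OF nyh near8[OF xyh(2) sup_maximizer_close[OF that xyh(2) M']]] .
    show "norm (xh - yh) \<le> 1" using xhyh by simp
    show "N > 0" using M(1) by (simp add: N_def)
  qed (use max in \<open>auto simp: f_def g_def\<close>)
qed

theorem theorem5p1:
  fixes u :: "real ^ 'n \<Rightarrow> real" and p \<delta> :: real
  assumes "1 < p"
    and "continuous_on (cball 0 1) u"
    and "viscosity_solution p (ball 0 1) u"
    and "0 < \<delta>" and "\<delta> < 1"
  shows "\<exists>C>0. \<forall>x\<in>ball 0 (1/4). \<forall>y\<in>ball 0 (1/4).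
           \<bar>u x - u y\<bar> \<le> C * norm (x - y) powr \<delta>"
proof -
  have "bounded (u ` cball 0 1)"
    by (intro compact_imp_bounded compact_continuous_image assms compact_cball)
  then obtain M where M: "M > 0" "\<And>x. x \<in> cball 0 1 \<Longrightarrow> \<bar>u x\<bar> \<le> M"
    by (auto simp: bounded_pos)
  define N where "N = 32 * M"
  define c where "c = (1 - \<delta>) * (p - 1)"
  have c: "c > 0" using assms by (simp add: c_def)
  \<comment> \<open>One summand for each lower bound imposed on \<open>L * \<delta>\<close>; the
    \<open>+ 1\<close> inside the last fraction makes the final inequality strict. The extra
    \<open>16 * M\<close> in \<open>L\<close> below serves the remaining requirement.\<close>
  define \<Lambda> where "\<Lambda> = N + 1 + 3 * p * N\<^sup>2 / c + (2 * N * (real CARD('n) + p) + 1) / c"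
  have N: "N > 0" using M by (simp add: N_def)
  have t: "3 * p * N\<^sup>2 / c \<ge> 0" "(2 * N * (real CARD('n) + p) + 1) / c \<ge> 0"
    using c N assms(1) by auto
  define L where "L = 16 * M + \<Lambda> / \<delta>"
  have \<Lambda>: "\<Lambda> \<ge> 0" using t N by (simp add: \<Lambda>_def)
  have L\<delta>: "L * \<delta> \<ge> \<Lambda>" using assms(4) M(1) by (simp add: L_def distrib_right)
  have cL: "c * \<Lambda> \<le> c * (L * \<delta>)" using c L\<delta> by simp
  have "c * (3 * p * N\<^sup>2 / c) \<le> c * \<Lambda>"
    using c N t by (intro mult_left_mono) (auto simp: \<Lambda>_def)
  moreover have "c * (3 * p * N\<^sup>2 / c) = 3 * p * N\<^sup>2" using c by simp
  ultimately have L4: "3 * p * N\<^sup>2 \<le> c * (L * \<delta>)" using cL by linarith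
  have "c * ((2 * N * (real CARD('n) + p) + 1) / c) \<le> c * \<Lambda>"
    using c N t by (intro mult_left_mono) (auto simp: \<Lambda>_def)
  moreover have "c * ((2 * N * (real CARD('n) + p) + 1) / c) = 2 * N * (real CARD('n) + p) + 1"
    using c by simp
  ultimately have L5: "2 * N * (real CARD('n) + p) < c * (L * \<delta>)" using cL by linarith
  have L1: "16 * M \<le> L" using \<Lambda> assms(4) by (simp add: L_def)
  have L23: "N \<le> L * \<delta>" "1 \<le> L * \<delta>" using L\<delta> t N by (auto simp: \<Lambda>_def)
  have osc: "u x - u y \<le> L * norm (x - y) powr \<delta>" if "x \<in> ball 0 (1/4)" "y \<in> ball 0 (1/4)" for x y
  proof -
    have "u x - u y \<le> L * ((norm (x - y))\<^sup>2) powr (\<delta> / 2)"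
      by (rule oscillation_bound[OF assms(2) viscosity_solution_subsolution[OF assms(3)]
            viscosity_solution_subsolution_minus[OF assms(3)] assms(1,4,5) M L1
            L23[unfolded N_def] L4[unfolded N_def c_def] L5[unfolded N_def c_def] that])
    also have "((norm (x - y))\<^sup>2) powr (\<delta> / 2) = norm (x - y) powr \<delta>"
      by (cases "x = y") (simp_all add: powr_powr flip: powr_numeral)
    finally show ?thesis .
  qed
  show ?thesis
  proof (intro exI[of _ L] conjI ballI)
    show "L > 0" using L1 M(1) by linarith
    fix x y :: "real ^ 'n" assume "x \<in> ball 0 (1/4)" "y \<in> ball 0 (1/4)"
    then show "\<bar>u x - u y\<bar> \<le> L * norm (x - y) powr \<delta>"
      using osc[of x y] osc[of y x] by (simp add: norm_minus_commute abs_le_iff)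
  qed
qed

end
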